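(* Let $X$ be a paracompact finite $C$-space, $(Y,\rho)$ a metric space, and $\varphi:X\rightrightarrows Y$ a $\rho$-continuous mapping such that each $\varphi(x)$, $x\in X$, is uniformly $UV^\omega$. Then for every continuous function $\varepsilon:X\to(0,+\infty)$, $\varphi$ has a continuous $\varepsilon$-selection.
   Context: A normal space $X$ is a finite $C$-space if for every sequence $\{\mathscr{U}_n:n<\omega\}$ of finite open covers of $X$ there is a finite sequence $\{\mathscr{V}_n:n\le k\}$ of families of pairwise disjoint open subsets of $X$ such that each $\mathscr{V}_n$ refines $\mathscr{U}_n$ and $\bigcup_{n\le k}\mathscr{V}_n$ covers $X$. A set-valued mapping $\varphi:X\rightrightarrows Y$ assigns a nonempty subset $\varphi(x)\subset Y$ to each $x$. $\mathbf{O}_\varepsilon(S)=\bigcup_{q\in S}\{y:\rho(y,q)<\varepsilon\}$. $\varphi$ is $\rho$-continuous if for every $\varepsilon>0$ each $x\in X$ has a neighbourhood $V$ with $\varphi(x)\subset\mathbf{O}_\varepsilon(\varphi(p))$ and $\varphi(p)\subset\mathbf{O}_\varepsilon(\varphi(x))$ for all $p\in V$. For $S\subset T$, $S\hookrightarrow_\omega T$ means that for every finite-dimensional simplicial complex $\Sigma$ (all simplices of cardinality at most some fixed $k+1$; geometric realisation $|\Sigma|$ with the Whitehead topology), every continuous map $g:|\Sigma|\to S$ is null-homotopic in $T$. A subset $S\subset Y$ is uniformly $UV^\omega$ if for each $\varepsilon>0$ there is $\delta\in(0,\varepsilon]$ with $\mathbf{O}_\delta(S)\hookrightarrow_\omega\mathbf{O}_\varepsilon(S)$.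 A map $f:X\to Y$ is an $\varepsilon$-selection for $\varphi$ if $f(x)\in\mathbf{O}_{\varepsilon(x)}(\varphi(x))$ for every $x\in X$. *)

theory Defs
  imports "HOL-Analysis.Analysis"
begin

text \<open>Paracompact (Engelking convention: Hausdorff, and every open cover has a
locally finite open refinement).\<close>
definition paracompact_space :: "'a topology \<Rightarrow> bool" where
  "paracompact_space X \<longleftrightarrow> Hausdorff_space X \<and>
     (\<forall>\<U>. (\<forall>U\<in>\<U>. openin X U) \<and> \<Union>\<U> = topspace X \<longrightarrow>
        (\<exists>\<V>. (\<forall>V\<in>\<V>. openin X V) \<and> \<Union>\<V> = topspace X \<and>
              (\<forall>V\<in>\<V>. \<exists>U\<in>\<U>. V \<subseteq> U) \<and> locally_finite_in X \<V>))"

definition finite_open_cover :: "'a topology \<Rightarrow> 'a set set \<Rightarrow> bool" where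
  "finite_open_cover X \<U> \<longleftrightarrow> finite \<U> \<and> (\<forall>U\<in>\<U>. openin X U) \<and> \<Union>\<U> = topspace X"

definition finite_C_space :: "'a topology \<Rightarrow> bool" where
  "finite_C_space X \<longleftrightarrow> normal_space X \<and>
     (\<forall>\<U> :: nat \<Rightarrow> 'a set set. (\<forall>n. finite_open_cover X (\<U> n)) \<longrightarrow>
        (\<exists>k. \<exists>\<V> :: nat \<Rightarrow> 'a set set.
           (\<forall>n\<le>k. (\<forall>V\<in>\<V> n. openin X V \<and> (\<exists>U\<in>\<U> n. V \<subseteq> U)) \<and> pairwise disjnt (\<V> n)) \<and>
           (\<Union>n\<le>k. \<Union>(\<V> n)) = topspace X))"

definition Onbhd :: "'b metric \<Rightarrow> real \<Rightarrow> 'b set \<Rightarrow> 'b set" where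
  "Onbhd m e S = {y \<in> mspace m. \<exists>q\<in>S. mdist m y q < e}"

definition rho_continuous :: "'a topology \<Rightarrow> 'b metric \<Rightarrow> ('a \<Rightarrow> 'b set) \<Rightarrow> bool" where
  "rho_continuous X m \<phi> \<longleftrightarrow>
     (\<forall>e>0. \<forall>x\<in>topspace X. \<exists>V. openin X V \<and> x \<in> V \<and>
        (\<forall>p\<in>V. \<phi> x \<subseteq> Onbhd m e (\<phi> p) \<and> \<phi> p \<subseteq> Onbhd m e (\<phi> x)))"

definition simplicial_complex :: "'v set set \<Rightarrow> bool" where
  "simplicial_complex \<Sigma> \<longleftrightarrow>
     (\<forall>\<sigma>\<in>\<Sigma>. finite \<sigma> \<and> \<sigma> \<noteq> {} \<and> (\<forall>\<tau>. \<tau> \<subseteq> \<sigma> \<and> \<tau> \<noteq> {} \<longrightarrow> \<tau> \<in> \<Sigma>))"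

definition finite_dimensional :: "'v set set \<Rightarrow> bool" where
  "finite_dimensional \<Sigma> \<longleftrightarrow> (\<exists>k::nat. \<forall>\<sigma>\<in>\<Sigma>. card \<sigma> \<le> k + 1)"

text \<open>Closed geometric simplex of \<sigma>, as barycentric coordinate functions.\<close>
definition geom_simplex :: "'v set \<Rightarrow> ('v \<Rightarrow> real) set" where
  "geom_simplex \<sigma> = {\<alpha>. (\<forall>v. 0 \<le> \<alpha> v) \<and> (\<forall>v. v \<notin> \<sigma> \<longrightarrow> \<alpha> v = 0) \<and> sum \<alpha> \<sigma> = 1}"

definition realization :: "'v set set \<Rightarrow> ('v \<Rightarrow> real) set" where
  "realization \<Sigma> = (\<Union>\<sigma>\<in>\<Sigma>. geom_simplex \<sigma>)"

text \<open>Whitehead (weak) topology: U is open iff its trace on every closed simplex is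
open in the Euclidean topology of that simplex.\<close>
definition whitehead_topology :: "'v set set \<Rightarrow> ('v \<Rightarrow> real) topology" where
  "whitehead_topology \<Sigma> = topology (\<lambda>U. U \<subseteq> realization \<Sigma> \<and>
      (\<forall>\<sigma>\<in>\<Sigma>. openin (subtopology (powertop_real UNIV) (geom_simplex \<sigma>)) (U \<inter> geom_simplex \<sigma>)))"

definition hook_omega :: "'v itself \<Rightarrow> 'b metric \<Rightarrow> 'b set \<Rightarrow> 'b set \<Rightarrow> bool" where
  "hook_omega _ m S T \<longleftrightarrow>
     (\<forall>(\<Sigma> :: 'v set set) (g :: ('v \<Rightarrow> real) \<Rightarrow> 'b).
        simplicial_complex \<Sigma> \<and> finite_dimensional \<Sigma> \<and>
        continuous_map (whitehead_topology \<Sigma>) (subtopology (mtopology_of m) S) g \<longrightarrow>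
        (\<exists>c. homotopic_with (\<lambda>h. True) (whitehead_topology \<Sigma>)
               (subtopology (mtopology_of m) T) g (\<lambda>_. c)))"

definition uniformly_UV_omega :: "'v itself \<Rightarrow> 'b metric \<Rightarrow> 'b set \<Rightarrow> bool" where
  "uniformly_UV_omega V m S \<longleftrightarrow>
     (\<forall>e>0. \<exists>d. 0 < d \<and> d \<le> e \<and> hook_omega V m (Onbhd m d S) (Onbhd m e S))"

end

theory Submission
  imports Defs
begin

text \<open>
  The finite C-property, assumed for finite covers only, extends to arbitrary open covers of a
  paracompact space. Call a set refinable if there is a bound d such that every open cover of X
  has d disjoint open families refining it and covering the set. Given a continuous real function
  f, the strips f^{-1}[n, n+1] with n large have uniformly bounded dimension: otherwise essential
  families of pairs on sparser and sparser strips glue to one sequence of pairs of disjoint closed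
  sets that contradicts the finite C-property. Hence some superlevel set of f is refinable. So the
  points without a refinable neighbourhood form a compact set K, and every closed set disjoint
  from K is refinable; K is handled with finite covers and the rest with boundedly many families.

  For the selection, choose continuous scales E 0 = \<epsilon>, E 1, E 2, ... and covers such that on each
  member of the n-th cover the E (n+1)-neighbourhoods of the values of \<phi> lie in a set that is
  contractible, in the sense of the UV property, inside all the E n-neighbourhoods. Disjoint
  families refining these covers have a finite-dimensional nerve, which is mapped to Y by
  descending induction on the level, coning off the link of each vertex. Composing with a
  partition of unity gives the selection.
\<close>

section \<open>Paracompact spaces\<close>

definition open_cover :: "'a topology \<Rightarrow> 'a set set \<Rightarrow> bool" where
  "open_cover X \<U> \<longleftrightarrow> (\<forall>U\<in>\<U>. openin X U) \<and> \<Union>\<U> = topspace X"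

lemma open_coverI:
  assumes "\<And>U. U \<in> \<U> \<Longrightarrow> openin X U" "\<And>x. x \<in> topspace X \<Longrightarrow> \<exists>U\<in>\<U>. x \<in> U"
  shows "open_cover X \<U>"
  using assms unfolding open_cover_def by (auto dest: openin_subset)

lemma paracompact_space_refinement:
  assumes "paracompact_space X" "open_cover X \<U>"
  obtains \<V> where "open_cover X \<V>" "locally_finite_in X \<V>" "\<And>V. V \<in> \<V> \<Longrightarrow> \<exists>U\<in>\<U>. V \<subseteq> U"
proof -
  obtain \<V> where "\<forall>V\<in>\<V>. openin X V" "\<Union>\<V> = topspace X" "\<forall>V\<in>\<V>. \<exists>U\<in>\<U>. V \<subseteq> U" "locally_finite_in X \<V>"
    using assms(1)[unfolded paracompact_space_def, THEN conjunct2, THEN spec, THEN mp,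
        OF assms(2)[unfolded open_cover_def]]
    by (elim exE conjE)
  then show ?thesis by (intro that[of \<V>]) (simp_all add: open_cover_def)
qed

lemma paracompact_space_locally_finite_open_cover:
  assumes paracompact: "paracompact_space X"
    and local: "\<And>x. x \<in> topspace X \<Longrightarrow> \<exists>G. openin X G \<and> x \<in> G \<and> P G"
    and hereditary: "\<And>G H. P G \<Longrightarrow> H \<subseteq> G \<Longrightarrow> P H"
  obtains \<W> where "open_cover X \<W>" "locally_finite_in X \<W>" "\<And>W. W \<in> \<W> \<Longrightarrow> P W"
proof -
  have "open_cover X {G. openin X G \<and> P G}"
    using local by (intro open_coverI) auto
  then obtain \<W> where \<W>: "open_cover X \<W>" "locally_finite_in X \<W>"
      "\<And>W. W \<in> \<W> \<Longrightarrow> \<exists>G\<in>{G. openin X G \<and> P G}. W \<subseteq> G"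
    using paracompact_space_refinement[OF paracompact] by blast
  have "P W" if "W \<in> \<W>" for W
    using \<W>(3)[OF that] hereditary by blast
  then show ?thesis by (rule that[OF \<W>(1,2)])
qed

lemma paracompact_space_separate_closed_from_points:
  assumes paracompact: "paracompact_space X" and closed: "closedin X A" "closedin X B"
    and points: "\<And>a. a \<in> A \<Longrightarrow> \<exists>U V. openin X U \<and> openin X V \<and> a \<in> U \<and> B \<subseteq> V \<and> disjnt U V"
  shows "\<exists>U V. openin X U \<and> openin X V \<and> A \<subseteq> U \<and> B \<subseteq> V \<and> disjnt U V"
proof -
  define P where "P G \<longleftrightarrow> G \<inter> A \<noteq> {} \<longrightarrow> disjnt (X closure_of G) B" for G
  have "\<exists>G. openin X G \<and> x \<in> G \<and> P G" if x: "x \<in> topspace X" for x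
  proof (cases "x \<in> A")
    case True
    then obtain U V where UV: "openin X U" "openin X V" "x \<in> U" "B \<subseteq> V" "disjnt U V"
      using points by blast
    then have "disjnt (X closure_of U) V"
      using openin_Int_closure_of_eq_empty[of X V U] by (auto simp: disjnt_def)
    then have "P U" using UV(4) by (auto simp: P_def disjnt_iff)
    then show ?thesis using UV by blast
  next
    case False
    then show ?thesis using x closed(1) by (intro exI[of _ "topspace X - A"]) (auto simp: P_def)
  qed
  moreover have "P H" if "P G" "H \<subseteq> G" for G H
    using that closure_of_mono[OF that(2), of X] by (auto simp: P_def disjnt_iff)
  ultimately obtain \<V> where \<V>: "open_cover X \<V>" "locally_finite_in X \<V>" "\<And>V. V \<in> \<V> \<Longrightarrow> P V"
    using paracompact_space_locally_finite_open_cover[OF paracompact, of P] by metis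
  define \<W> where "\<W> = {V\<in>\<V>. V \<inter> A \<noteq> {}}"
  have "locally_finite_in X \<W>"
    by (rule locally_finite_in_subset[OF \<V>(2)]) (auto simp: \<W>_def)
  then have "X closure_of \<Union>\<W> = (\<Union>V\<in>\<W>. X closure_of V)"
    by (rule closure_of_locally_finite_Union)
  moreover have "disjnt (X closure_of V) B" if "V \<in> \<W>" for V
    using \<V>(3) that by (auto simp: \<W>_def P_def)
  ultimately have "disjnt (X closure_of \<Union>\<W>) B" by auto
  then have "B \<subseteq> topspace X - X closure_of \<Union>\<W>"
    using closedin_subset[OF closed(2)] by (auto simp: disjnt_iff)
  moreover have "openin X (\<Union>\<W>)" using \<V>(1) by (auto simp: \<W>_def open_cover_def)
  moreover have "A \<subseteq> \<Union>\<W>"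
    using \<V>(1) closedin_subset[OF closed(1)] unfolding \<W>_def open_cover_def by blast
  moreover have "disjnt (\<Union>\<W>) (topspace X - X closure_of \<Union>\<W>)"
    using closure_of_subset[OF openin_subset[OF \<open>openin X (\<Union>\<W>)\<close>]] by (auto simp: disjnt_iff)
  moreover have "openin X (topspace X - X closure_of \<Union>\<W>)"
    by (simp add: openin_diff)
  ultimately show ?thesis by blast
qed

lemma paracompact_imp_normal_space:
  assumes "paracompact_space X"
  shows "normal_space X"
  unfolding normal_space_def
proof (intro allI impI, elim conjE)
  fix C D assume closed: "closedin X C" "closedin X D" and "disjnt C D"
  have hausdorff: "Hausdorff_space X" using assms by (simp add: paracompact_space_def)
  have "\<exists>U V. openin X U \<and> openin X V \<and> x \<in> U \<and> D \<subseteq> V \<and> disjnt U V" if "x \<in> C" for x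
  proof -
    have "x \<in> topspace X" using that closed closedin_subset by blast
    then have "closedin X {x}" by (simp add: closedin_Hausdorff_singleton hausdorff)
    moreover have "\<exists>U V. openin X U \<and> openin X V \<and> y \<in> U \<and> {x} \<subseteq> V \<and> disjnt U V" if "y \<in> D" for y
    proof -
      have "y \<in> topspace X" "y \<noteq> x"
        using that \<open>x \<in> C\<close> \<open>disjnt C D\<close> closedin_subset[OF closed(2)] by (auto simp: disjnt_iff)
      then show ?thesis
        using hausdorff \<open>x \<in> topspace X\<close> unfolding Hausdorff_space_def
        by (meson empty_subsetI insert_subset)
    qed
    ultimately show ?thesis
      using paracompact_space_separate_closed_from_points[OF assms closed(2), of "{x}"]
      by (meson disjnt_sym insert_subset)
  qed
  then show "\<exists>U V. openin X U \<and> openin X V \<and> C \<subseteq> U \<and> D \<subseteq> V \<and> disjnt U V"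
    by (rule paracompact_space_separate_closed_from_points[OF assms closed])
qed

definition locally_finite_family :: "'a topology \<Rightarrow> 'i set \<Rightarrow> ('i \<Rightarrow> 'a set) \<Rightarrow> bool" where
  "locally_finite_family X I A \<longleftrightarrow>
     (\<forall>x\<in>topspace X. \<exists>N. openin X N \<and> x \<in> N \<and> finite {i\<in>I. A i \<inter> N \<noteq> {}})"

lemma locally_finite_family_subsets:
  assumes "locally_finite_family X I A" "J \<subseteq> I" "\<And>i. i \<in> J \<Longrightarrow> B i \<subseteq> A i"
  shows "locally_finite_family X J B"
  unfolding locally_finite_family_def
proof
  fix x assume "x \<in> topspace X"
  then obtain N where N: "openin X N" "x \<in> N" "finite {i\<in>I. A i \<inter> N \<noteq> {}}"
    using assms(1) unfolding locally_finite_family_def by blast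
  have "{i\<in>J. B i \<inter> N \<noteq> {}} \<subseteq> {i\<in>I. A i \<inter> N \<noteq> {}}" using assms(2,3) by blast
  then show "\<exists>N. openin X N \<and> x \<in> N \<and> finite {i\<in>J. B i \<inter> N \<noteq> {}}"
    using N finite_subset by blast
qed

lemma closedin_UN_locally_finite_family:
  assumes "locally_finite_family X I A" "\<And>i. i \<in> I \<Longrightarrow> closedin X (A i)"
  shows "closedin X (\<Union>i\<in>I. A i)"
proof (rule closedin_locally_finite_Union)
  show "locally_finite_in X (A ` I)"
    unfolding locally_finite_in_def
  proof (intro conjI ballI)
    fix x assume "x \<in> topspace X"
    then obtain N where N: "openin X N" "x \<in> N" "finite {i\<in>I. A i \<inter> N \<noteq> {}}"
      using assms(1) unfolding locally_finite_family_def by blast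
    have "{S \<in> A ` I. S \<inter> N \<noteq> {}} \<subseteq> A ` {i\<in>I. A i \<inter> N \<noteq> {}}" by blast
    then show "\<exists>N. openin X N \<and> x \<in> N \<and> finite {S \<in> A ` I. S \<inter> N \<noteq> {}}"
      using N by (meson finite_imageI finite_subset)
  qed (use assms(2) closedin_subset in blast)
qed (use assms(2) in blast)

definition indexed_open_cover :: "'a topology \<Rightarrow> 'i set \<Rightarrow> ('i \<Rightarrow> 'a set) \<Rightarrow> bool" where
  "indexed_open_cover X I U \<longleftrightarrow> (\<forall>i\<in>I. openin X (U i)) \<and> topspace X \<subseteq> (\<Union>i\<in>I. U i)"

lemma indexed_open_cover_ident: "indexed_open_cover X \<U> (\<lambda>U. U) \<longleftrightarrow> open_cover X \<U>"
  unfolding indexed_open_cover_def open_cover_def by (auto dest: openin_subset)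

lemma indexed_open_cover_subset_closure:
  assumes "indexed_open_cover X I U" "i \<in> I"
  shows "U i \<subseteq> X closure_of (U i)"
  using assms by (intro closure_of_subset openin_subset) (simp add: indexed_open_cover_def)

lemma paracompact_space_refinement_with_closures:
  assumes paracompact: "paracompact_space X" and U: "indexed_open_cover X I U"
  obtains \<W> where "open_cover X \<W>" "locally_finite_in X \<W>"
    "\<And>W. W \<in> \<W> \<Longrightarrow> \<exists>i\<in>I. X closure_of W \<subseteq> U i"
proof -
  define P where "P G \<longleftrightarrow> (\<exists>i\<in>I. X closure_of G \<subseteq> U i)" for G
  have "\<exists>G. openin X G \<and> x \<in> G \<and> P G" if x: "x \<in> topspace X" for x
  proof -
    obtain i where i: "i \<in> I" "x \<in> U i" "openin X (U i)"
      using U x unfolding indexed_open_cover_def by blast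
    have "closedin X {x}"
      using paracompact x by (simp add: closedin_Hausdorff_singleton paracompact_space_def)
    then obtain G where "openin X G" "{x} \<subseteq> G" "X closure_of G \<subseteq> U i"
      using paracompact_imp_normal_space[OF paracompact] i unfolding normal_space_alt
      by (metis empty_subsetI insert_subset)
    then show ?thesis using i(1) by (auto simp: P_def)
  qed
  moreover have "P H" if "P G" "H \<subseteq> G" for G H
    using that closure_of_mono[OF that(2), of X] unfolding P_def by blast
  ultimately obtain \<W> where \<W>: "open_cover X \<W>" "locally_finite_in X \<W>" "\<And>W. W \<in> \<W> \<Longrightarrow> P W"
    using paracompact_space_locally_finite_open_cover[OF paracompact, of P] by metis
  then show ?thesis using that unfolding P_def by metis
qed

lemma paracompact_space_shrinking:
  assumes paracompact: "paracompact_space X" and U: "indexed_open_cover X I U"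
  obtains W where "indexed_open_cover X I W" "\<And>i. i \<in> I \<Longrightarrow> X closure_of (W i) \<subseteq> U i"
    "locally_finite_family X I W"
proof -
  obtain \<W> where \<W>: "open_cover X \<W>" "locally_finite_in X \<W>"
      "\<And>W. W \<in> \<W> \<Longrightarrow> \<exists>i\<in>I. X closure_of W \<subseteq> U i"
    by (rule paracompact_space_refinement_with_closures[OF paracompact U]) (rule that)
  then obtain s where s: "\<And>V. V \<in> \<W> \<Longrightarrow> s V \<in> I \<and> X closure_of V \<subseteq> U (s V)" by metis
  define W where "W i = \<Union>{V\<in>\<W>. s V = i}" for i
  have "\<exists>i\<in>I. x \<in> W i" if "x \<in> topspace X" for x
  proof -
    obtain V where "V \<in> \<W>" "x \<in> V" using \<W>(1) \<open>x \<in> topspace X\<close> unfolding open_cover_def by blast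
    then show ?thesis using s[of V] by (auto simp: W_def)
  qed
  moreover have "openin X (W i)" for i using \<W>(1) by (auto simp: W_def open_cover_def)
  ultimately have "indexed_open_cover X I W" by (auto simp: indexed_open_cover_def)
  moreover have "X closure_of (W i) \<subseteq> U i" for i
  proof -
    have "locally_finite_in X {V\<in>\<W>. s V = i}"
      by (rule locally_finite_in_subset[OF \<W>(2)]) auto
    then have "X closure_of (W i) = (\<Union>V\<in>{V\<in>\<W>. s V = i}. X closure_of V)"
      unfolding W_def by (rule closure_of_locally_finite_Union)
    then show ?thesis using s by blast
  qed
  moreover have "locally_finite_family X I W"
    unfolding locally_finite_family_def
  proof
    fix x assume "x \<in> topspace X"
    then obtain N where N: "openin X N" "x \<in> N" "finite {V\<in>\<W>. V \<inter> N \<noteq> {}}"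
      using \<W>(2) unfolding locally_finite_in_def by blast
    have "{i\<in>I. W i \<inter> N \<noteq> {}} \<subseteq> s ` {V\<in>\<W>. V \<inter> N \<noteq> {}}" unfolding W_def by blast
    then show "\<exists>N. openin X N \<and> x \<in> N \<and> finite {i\<in>I. W i \<inter> N \<noteq> {}}"
      using N by (meson finite_imageI finite_subset)
  qed
  ultimately show ?thesis using that by blast
qed

section \<open>Bump families\<close>

locale bump_family =
  fixes X :: "'a topology" and I :: "'i set" and U :: "'i \<Rightarrow> 'a set" and u :: "'i \<Rightarrow> 'a \<Rightarrow> real"
  assumes continuous: "i \<in> I \<Longrightarrow> continuous_map X euclideanreal (u i)"
    and nonneg: "i \<in> I \<Longrightarrow> x \<in> topspace X \<Longrightarrow> 0 \<le> u i x"
    and le_one: "i \<in> I \<Longrightarrow> x \<in> topspace X \<Longrightarrow> u i x \<le> 1"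
    and subordinate: "i \<in> I \<Longrightarrow> x \<in> topspace X \<Longrightarrow> u i x \<noteq> 0 \<Longrightarrow> x \<in> U i"
    and ex_peak: "x \<in> topspace X \<Longrightarrow> \<exists>i\<in>I. u i x = 1"
    and locally_finite: "locally_finite_family X I (\<lambda>i. {x \<in> topspace X. u i x \<noteq> 0})"

lemma normal_space_bump_function:
  assumes "normal_space X" "openin X W" "closedin X C" "C \<subseteq> W"
  shows "\<exists>f. continuous_map X euclideanreal f \<and> (\<forall>x\<in>topspace X. 0 \<le> f x \<and> f x \<le> 1) \<and>
      {x \<in> topspace X. f x \<noteq> 0} \<subseteq> W \<and> (\<forall>x\<in>C. f x = 1)"
proof -
  have "\<exists>f. continuous_map X (top_of_set {0..1::real}) f \<and> f ` (topspace X - W) \<subseteq> {0} \<and> f ` C \<subseteq> {1}"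
    by (rule Urysohn_lemma[OF assms(1), of "topspace X - W" C 0 1])
       (use assms in \<open>auto simp: disjnt_iff\<close>)
  then obtain f where f: "continuous_map X (top_of_set {0..1::real}) f" "f ` (topspace X - W) \<subseteq> {0}"
    "f ` C \<subseteq> {1}"
    by blast
  have "f x \<in> {0..1}" if "x \<in> topspace X" for x
    using continuous_map_image_subset_topspace[OF f(1)] that by auto
  moreover have "continuous_map X euclideanreal f"
    using f(1) by (simp add: continuous_map_in_subtopology)
  ultimately show ?thesis using f(2,3) by (intro exI[of _ f]) auto
qed

lemma paracompact_space_bump_family:
  assumes paracompact: "paracompact_space X" and U: "indexed_open_cover X I U"
  obtains u where "bump_family X I U u"
proof -
  obtain W where W: "indexed_open_cover X I W" "\<And>i. i \<in> I \<Longrightarrow> X closure_of (W i) \<subseteq> U i"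
    "locally_finite_family X I W"
    by (rule paracompact_space_shrinking[OF paracompact U]) (rule that)
  obtain Z where Z: "indexed_open_cover X I Z" "\<And>i. i \<in> I \<Longrightarrow> X closure_of (Z i) \<subseteq> W i"
    by (rule paracompact_space_shrinking[OF paracompact W(1)]) (rule that)
  have "\<forall>i\<in>I. \<exists>f. continuous_map X euclideanreal f \<and> (\<forall>x\<in>topspace X. 0 \<le> f x \<and> f x \<le> 1) \<and>
      {x \<in> topspace X. f x \<noteq> 0} \<subseteq> W i \<and> (\<forall>x\<in>X closure_of (Z i). f x = 1)"
    using W(1) Z(2)
    by (intro ballI normal_space_bump_function paracompact_imp_normal_space[OF paracompact])
       (auto simp: indexed_open_cover_def)
  then obtain u
    where u: "\<forall>i\<in>I. continuous_map X euclideanreal (u i) \<and> (\<forall>x\<in>topspace X. 0 \<le> u i x \<and> u i x \<le> 1) \<and>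
      {x \<in> topspace X. u i x \<noteq> 0} \<subseteq> W i \<and> (\<forall>x\<in>X closure_of (Z i). u i x = 1)"
    unfolding bchoice_iff by (elim exE)
  then have support: "{x \<in> topspace X. u i x \<noteq> 0} \<subseteq> W i" if "i \<in> I" for i using that by blast
  have "bump_family X I U u"
  proof
    show "x \<in> U i" if "i \<in> I" "x \<in> topspace X" "u i x \<noteq> 0" for i x
      using that support[of i] W(2)[of i] indexed_open_cover_subset_closure[OF W(1), of i] by blast
    show "\<exists>i\<in>I. u i x = 1" if x: "x \<in> topspace X" for x
    proof -
      obtain i where "i \<in> I" "x \<in> Z i" using Z(1) x unfolding indexed_open_cover_def by blast
      then show ?thesis using u indexed_open_cover_subset_closure[OF Z(1)] by blast
    qed
    show "locally_finite_family X I (\<lambda>i. {x \<in> topspace X. u i x \<noteq> 0})"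
      by (rule locally_finite_family_subsets[OF W(3) subset_refl support])
  qed (use u in auto)
  then show ?thesis using that by blast
qed

lemma continuous_map_locally:
  assumes "\<And>x. x \<in> topspace X \<Longrightarrow> \<exists>N. openin X N \<and> x \<in> N \<and> continuous_map (subtopology X N) Y f"
  shows "continuous_map X Y f"
proof -
  obtain N
    where N: "\<And>x. x \<in> topspace X \<Longrightarrow> openin X (N x) \<and> x \<in> N x \<and> continuous_map (subtopology X (N x)) Y f"
    using assms by metis
  show ?thesis
    by (rule pasting_lemma[where I="topspace X" and T=N and f="\<lambda>_. f"]) (use N in auto)
qed

lemma openin_Collect_less:
  assumes "continuous_map X euclideanreal f" "continuous_map X euclideanreal g"
  shows "openin X {x \<in> topspace X. f x < g x}"
proof -
  have "openin X {x \<in> topspace X. g x - f x \<in> {0<..}}"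
    by (rule openin_continuous_map_preimage[OF continuous_map_diff[OF assms(2,1)]]) auto
  then show ?thesis by (simp cong: conj_cong)
qed

lemma openin_Collect_finite_ball:
  assumes "finite F" "\<And>i. i \<in> F \<Longrightarrow> openin X {x \<in> topspace X. P i x}"
  shows "openin X {x \<in> topspace X. \<forall>i\<in>F. P i x}"
proof -
  have "(\<Inter>i\<in>F. {x \<in> topspace X. P i x}) \<inter> topspace X = {x \<in> topspace X. \<forall>i\<in>F. P i x}" by auto
  then show ?thesis using openin_INT[of F X "\<lambda>i. {x \<in> topspace X. P i x}"] assms by simp
qed

context bump_family
begin

lemma finite_local_support:
  assumes "x \<in> topspace X"
  obtains N where "openin X N" "x \<in> N" "finite {i\<in>I. \<exists>y\<in>N. u i y \<noteq> 0}"
proof -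
  obtain N where N: "openin X N" "x \<in> N" "finite {i\<in>I. {y \<in> topspace X. u i y \<noteq> 0} \<inter> N \<noteq> {}}"
    using locally_finite assms unfolding locally_finite_family_def by blast
  have "{i\<in>I. \<exists>y\<in>N. u i y \<noteq> 0} = {i\<in>I. {y \<in> topspace X. u i y \<noteq> 0} \<inter> N \<noteq> {}}"
    using openin_subset[OF N(1)] by blast
  then show ?thesis using N that by simp
qed

lemma finite_support:
  assumes "x \<in> topspace X"
  shows "finite {i\<in>I. u i x \<noteq> 0}"
proof -
  obtain N where N: "x \<in> N" "finite {i\<in>I. \<exists>y\<in>N. u i y \<noteq> 0}"
    using finite_local_support[OF assms] by blast
  show ?thesis
    by (rule finite_subset[OF _ N(2)]) (use N(1) in blast)
qed

definition weighted_sum :: "('i \<Rightarrow> real) \<Rightarrow> 'a \<Rightarrow> real" where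
  "weighted_sum c x = (\<Sum>i\<in>{i\<in>I. u i x \<noteq> 0}. c i * u i x)"

lemma continuous_map_weighted_sum: "continuous_map X euclideanreal (weighted_sum c)"
proof (rule continuous_map_locally)
  fix x assume "x \<in> topspace X"
  then obtain N where N: "openin X N" "x \<in> N" and fin: "finite {i\<in>I. \<exists>y\<in>N. u i y \<noteq> 0}"
    by (rule finite_local_support)
  let ?F = "{i\<in>I. \<exists>y\<in>N. u i y \<noteq> 0}"
  have "continuous_map (subtopology X N) euclideanreal (weighted_sum c)"
  proof (rule continuous_map_eq)
    have "continuous_map (subtopology X N) euclideanreal (u i)" if "i \<in> I" for i
      using continuous[OF that] continuous_map_from_subtopology by blast
    then show "continuous_map (subtopology X N) euclideanreal (\<lambda>y. \<Sum>i\<in>?F. c i * u i y)"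
      using fin by (intro continuous_intros) auto
    show "(\<Sum>i\<in>?F. c i * u i y) = weighted_sum c y" if "y \<in> topspace (subtopology X N)" for y
      unfolding weighted_sum_def
      by (rule sum.mono_neutral_right[OF fin]) (use that in auto)
  qed
  then show "\<exists>N. openin X N \<and> x \<in> N \<and> continuous_map (subtopology X N) euclideanreal (weighted_sum c)"
    using N by blast
qed

definition peaks :: "'a \<Rightarrow> 'i set" where
  "peaks x = {i\<in>I. u i x = 1}"

lemma finite_peaks:
  assumes "x \<in> topspace X"
  shows "finite (peaks x)"
  by (rule finite_subset[OF _ finite_support[OF assms]]) (auto simp: peaks_def)

lemma peaks_nonempty:
  assumes "x \<in> topspace X"
  shows "peaks x \<noteq> {}"
  using ex_peak[OF assms] by (auto simp: peaks_def)

lemma peak_subordinate: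
  assumes "x \<in> topspace X" "i \<in> peaks x"
  shows "i \<in> I" "x \<in> U i"
  using subordinate[OF _ assms(1), of i] assms(2) by (auto simp: peaks_def)

lemma sum_peaks_le_weighted_sum:
  assumes x: "x \<in> topspace X" and c_nonneg: "\<And>i. i \<in> I \<Longrightarrow> 0 \<le> c i"
  shows "sum c (peaks x) \<le> weighted_sum c x"
proof -
  have "sum c (peaks x) = (\<Sum>i\<in>peaks x. c i * u i x)"
    by (intro sum.cong) (auto simp: peaks_def)
  also have "\<dots> \<le> weighted_sum c x"
    unfolding weighted_sum_def
    by (rule sum_mono2[OF finite_support[OF x]]) (use c_nonneg nonneg[OF _ x] in \<open>auto simp: peaks_def\<close>)
  finally show ?thesis .
qed

lemma peak_le_weighted_sum:
  assumes x: "x \<in> topspace X" and c_nonneg: "\<And>i. i \<in> I \<Longrightarrow> 0 \<le> c i" and i: "i \<in> peaks x"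
  shows "c i \<le> weighted_sum c x"
proof -
  have "c i \<le> sum c (peaks x)"
    using c_nonneg by (intro member_le_sum i finite_peaks x) (auto simp: peaks_def)
  then show ?thesis using sum_peaks_le_weighted_sum[of x c] x c_nonneg by fastforce
qed

lemma weighted_sum_pos:
  assumes x: "x \<in> topspace X" and c_pos: "\<And>i. i \<in> I \<Longrightarrow> 0 < c i"
  shows "0 < weighted_sum c x"
proof -
  obtain i where i: "i \<in> peaks x" using peaks_nonempty[OF x] by blast
  have "c i \<le> weighted_sum c x"
    using c_pos by (intro peak_le_weighted_sum x i) (auto intro: less_imp_le)
  then show ?thesis using c_pos[OF peak_subordinate(1)[OF x i]] by linarith
qed

lemma card_peaks_le_weighted_sum:
  assumes x: "x \<in> topspace X" and c_ge_one: "\<And>i. i \<in> I \<Longrightarrow> 1 \<le> c i"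
  shows "real (card (peaks x)) \<le> weighted_sum c x"
proof -
  have "real (card (peaks x)) \<le> sum c (peaks x)"
    using sum_mono[of "peaks x" "\<lambda>_. 1" c] c_ge_one by (simp add: peaks_def)
  also have "\<dots> \<le> weighted_sum c x"
    by (rule sum_peaks_le_weighted_sum[OF x]) (use c_ge_one order_trans[OF zero_le_one] in blast)
  finally show ?thesis .
qed

end

lemma paracompact_space_positive_minorant:
  assumes paracompact: "paracompact_space X" and U: "indexed_open_cover X I U"
    and d: "\<forall>i\<in>I. 0 < d i"
  obtains e where "continuous_map X euclideanreal e" "\<And>x. x \<in> topspace X \<Longrightarrow> 0 < e x"
    "\<And>x. x \<in> topspace X \<Longrightarrow> \<exists>i\<in>I. x \<in> U i \<and> e x < d i"
proof -
  obtain u where "bump_family X I U u" by (rule paracompact_space_bump_family[OF paracompact U])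
  then interpret bump_family X I U u .
  let ?one = "\<lambda>_. 1 :: real"
  define e where "e x = weighted_sum d x / (2 * weighted_sum ?one x)" for x
  have pos: "0 < weighted_sum d x" "0 < weighted_sum ?one x" if "x \<in> topspace X" for x
    using d by (auto intro!: weighted_sum_pos[OF that])
  have "continuous_map X euclideanreal e"
    unfolding e_def
    by (intro continuous_map_real_divide continuous_map_real_mult_left continuous_map_weighted_sum)
       (use pos in force)
  moreover have "0 < e x" if "x \<in> topspace X" for x
    using pos[OF that] by (simp add: e_def)
  moreover have "\<exists>i\<in>I. x \<in> U i \<and> e x < d i" if x: "x \<in> topspace X" for x
  proof (rule ccontr)
    assume none: "\<not> ?thesis"
    have "d i * u i x \<le> e x * (1 * u i x)" if "i \<in> {i\<in>I. u i x \<noteq> 0}" for i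
    proof -
      have "d i \<le> e x" using none subordinate[OF _ x, of i] that by auto
      then show ?thesis using nonneg[OF _ x, of i] that by (auto intro: mult_right_mono)
    qed
    then have "weighted_sum d x \<le> e x * weighted_sum ?one x"
      unfolding weighted_sum_def sum_distrib_left by (rule sum_mono)
    also have "\<dots> = weighted_sum d x / 2" using pos(2)[OF x] by (simp add: e_def)
    finally show False using pos(1)[OF x] by simp
  qed
  ultimately show ?thesis by (rule that)
qed

section \<open>Disjoint open refinements\<close>

definition disjoint_open_refinement :: "'a topology \<Rightarrow> 'a set set \<Rightarrow> 'a set set \<Rightarrow> bool" where
  "disjoint_open_refinement X \<U> \<V> \<longleftrightarrow>
     pairwise disjnt \<V> \<and> (\<forall>V\<in>\<V>. openin X V \<and> (\<exists>U\<in>\<U>. V \<subseteq> U))"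

definition disjoint_refinements :: "'a topology \<Rightarrow> nat \<Rightarrow> (nat \<Rightarrow> 'a set set) \<Rightarrow> 'a set \<Rightarrow> bool" where
  "disjoint_refinements X d \<U> A \<longleftrightarrow>
     (\<exists>\<V>. (\<forall>n<d. disjoint_open_refinement X (\<U> n) (\<V> n)) \<and> A \<subseteq> (\<Union>n<d. \<Union>(\<V> n)))"

lemma disjoint_open_refinementI:
  assumes "\<And>V W. V \<in> \<V> \<Longrightarrow> W \<in> \<V> \<Longrightarrow> V \<noteq> W \<Longrightarrow> disjnt V W"
    and "\<And>V. V \<in> \<V> \<Longrightarrow> openin X V" and "\<And>V. V \<in> \<V> \<Longrightarrow> \<exists>U\<in>\<U>. V \<subseteq> U"
  shows "disjoint_open_refinement X \<U> \<V>"
  using assms by (simp add: disjoint_open_refinement_def pairwise_def)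

lemma disjoint_open_refinementD:
  assumes "disjoint_open_refinement X \<U> \<V>"
  shows "\<And>V W. V \<in> \<V> \<Longrightarrow> W \<in> \<V> \<Longrightarrow> V \<noteq> W \<Longrightarrow> disjnt V W"
    and "\<And>V. V \<in> \<V> \<Longrightarrow> openin X V" and "\<And>V. V \<in> \<V> \<Longrightarrow> \<exists>U\<in>\<U>. V \<subseteq> U"
  using assms by (simp_all add: disjoint_open_refinement_def pairwise_def)

lemma disjoint_open_refinement_trans:
  assumes "disjoint_open_refinement X \<U> \<V>" "\<And>U. U \<in> \<U> \<Longrightarrow> \<exists>U'\<in>\<U>'. U \<subseteq> U'"
  shows "disjoint_open_refinement X \<U>' \<V>"
  using assms unfolding disjoint_open_refinement_def by (meson subset_trans)

lemma disjoint_open_refinement_Int: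
  assumes "disjoint_open_refinement X \<G> \<V>" "\<And>V. V \<in> \<V> \<Longrightarrow> disjoint_open_refinement X \<U> (\<D> V)"
  shows "disjoint_open_refinement X \<U> (\<Union>V\<in>\<V>. (\<inter>) V ` \<D> V)"
proof (rule disjoint_open_refinementI)
  fix S T assume "S \<in> (\<Union>V\<in>\<V>. (\<inter>) V ` \<D> V)" "T \<in> (\<Union>V\<in>\<V>. (\<inter>) V ` \<D> V)" "S \<noteq> T"
  then obtain V D W E where VD: "S = V \<inter> D" "V \<in> \<V>" "D \<in> \<D> V" and WE: "T = W \<inter> E" "W \<in> \<V>" "E \<in> \<D> W"
    by blast
  have "disjnt V W \<or> disjnt D E"
    using disjoint_open_refinementD(1)[OF assms(1) VD(2) WE(2)]
      disjoint_open_refinementD(1)[OF assms(2)[OF VD(2)] VD(3)] VD WE \<open>S \<noteq> T\<close> by blast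
  then show "disjnt S T" using VD WE by (auto simp: disjnt_iff)
next
  fix S assume "S \<in> (\<Union>V\<in>\<V>. (\<inter>) V ` \<D> V)"
  then obtain V D where VD: "S = V \<inter> D" "V \<in> \<V>" "D \<in> \<D> V" by blast
  then show "openin X S"
    using disjoint_open_refinementD(2)[OF assms(1)] disjoint_open_refinementD(2)[OF assms(2)]
    by auto
  obtain U where "U \<in> \<U>" "D \<subseteq> U"
    using disjoint_open_refinementD(3)[OF assms(2)[OF VD(2)] VD(3)] by blast
  then show "\<exists>U\<in>\<U>. S \<subseteq> U" using VD(1) by blast
qed

lemma disjoint_refinementsI:
  assumes "\<And>n. n < d \<Longrightarrow> disjoint_open_refinement X (\<U> n) (\<V> n)" "A \<subseteq> (\<Union>n<d. \<Union>(\<V> n))"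
  shows "disjoint_refinements X d \<U> A"
  using assms unfolding disjoint_refinements_def by blast

lemma disjoint_refinementsE:
  assumes "disjoint_refinements X d \<U> A"
  obtains \<V> where "\<And>n. n < d \<Longrightarrow> disjoint_open_refinement X (\<U> n) (\<V> n)" "A \<subseteq> (\<Union>n<d. \<Union>(\<V> n))"
  using assms unfolding disjoint_refinements_def by blast

lemma disjoint_refinements_subset:
  assumes "disjoint_refinements X d \<U> A" "B \<subseteq> A"
  shows "disjoint_refinements X d \<U> B"
  using assms unfolding disjoint_refinements_def
  by (elim exE conjE) (intro exI conjI, assumption, blast)

lemma disjoint_refinements_Un:
  assumes "disjoint_refinements X d \<U> A" "disjoint_refinements X e (\<lambda>n. \<U> (d + n)) B"
  shows "disjoint_refinements X (d + e) \<U> (A \<union> B)"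
proof -
  obtain \<V> where \<V>: "\<And>n. n < d \<Longrightarrow> disjoint_open_refinement X (\<U> n) (\<V> n)" "A \<subseteq> (\<Union>n<d. \<Union>(\<V> n))"
    by (rule disjoint_refinementsE[OF assms(1)]) (rule that)
  obtain \<W> where \<W>: "\<And>n. n < e \<Longrightarrow> disjoint_open_refinement X (\<U> (d + n)) (\<W> n)"
      "B \<subseteq> (\<Union>n<e. \<Union>(\<W> n))"
    by (rule disjoint_refinementsE[OF assms(2)]) (rule that)
  define \<Z> where "\<Z> n = (if n < d then \<V> n else \<W> (n - d))" for n
  show ?thesis
  proof (rule disjoint_refinementsI)
    show "disjoint_open_refinement X (\<U> n) (\<Z> n)" if "n < d + e" for n
      using \<V>(1)[of n] \<W>(1)[of "n - d"] that by (auto simp: \<Z>_def)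
    have "(\<Union>n<d. \<Union>(\<V> n)) \<subseteq> (\<Union>n<d + e. \<Union>(\<Z> n))"
      by (rule UN_mono) (auto simp: \<Z>_def)
    moreover have "(\<Union>n<e. \<Union>(\<W> n)) \<subseteq> (\<Union>n<d + e. \<Union>(\<Z> n))"
    proof (rule UN_least)
      fix n assume "n \<in> {..<e}"
      then show "\<Union>(\<W> n) \<subseteq> (\<Union>n<d + e. \<Union>(\<Z> n))"
        using UN_upper[of "d + n" "{..<d + e}" "\<lambda>n. \<Union>(\<Z> n)"] by (simp add: \<Z>_def)
    qed
    ultimately show "A \<union> B \<subseteq> (\<Union>n<d + e. \<Union>(\<Z> n))"
      using \<V>(2) \<W>(2) by (meson Un_least subset_trans)
  qed
qed

lemma disjoint_refinements_UN_lessThan: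
  assumes "\<And>j. j < n \<Longrightarrow> disjoint_refinements X d (\<lambda>_. \<U>) (A j)"
  shows "disjoint_refinements X (n * d) (\<lambda>_. \<U>) (\<Union>j<n. A j)"
  using assms
proof (induction n)
  case 0
  then show ?case by (auto simp: disjoint_refinements_def)
next
  case (Suc n)
  have "disjoint_refinements X (d + n * d) (\<lambda>_. \<U>) (A n \<union> (\<Union>j<n. A j))"
    by (intro disjoint_refinements_Un Suc) auto
  then show ?case by (simp add: lessThan_Suc)
qed

lemma disjoint_refinements_mono:
  assumes "disjoint_refinements X d \<U> A" "d \<le> e"
  shows "disjoint_refinements X e \<U> A"
proof -
  have "disjoint_refinements X (e - d) (\<lambda>n. \<U> (d + n)) {}"
    by (rule disjoint_refinementsI[where \<V>="\<lambda>_. {}"]) (auto simp: disjoint_open_refinement_def)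
  from disjoint_refinements_Un[OF assms(1) this] assms(2) show ?thesis by simp
qed

lemma disjoint_refinements_disjoint_UN:
  assumes disj: "disjoint_open_refinement X \<G> \<W>"
    and ref: "\<And>W. W \<in> \<W> \<Longrightarrow> disjoint_refinements X d \<U> (A \<inter> W)"
  shows "disjoint_refinements X d \<U> (A \<inter> \<Union>\<W>)"
proof -
  obtain \<V> where \<V>: "\<forall>W\<in>\<W>. (\<forall>n<d. disjoint_open_refinement X (\<U> n) (\<V> W n)) \<and>
      A \<inter> W \<subseteq> (\<Union>n<d. \<Union>(\<V> W n))"
    using ref unfolding disjoint_refinements_def by metis
  show ?thesis
  proof (rule disjoint_refinementsI)
    show "disjoint_open_refinement X (\<U> n) (\<Union>W\<in>\<W>. (\<inter>) W ` \<V> W n)" if "n < d" for n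
      using \<V> that by (intro disjoint_open_refinement_Int[OF disj]) simp
    show "A \<inter> \<Union>\<W> \<subseteq> (\<Union>n<d. \<Union>(\<Union>W\<in>\<W>. (\<inter>) W ` \<V> W n))"
    proof
      fix x assume "x \<in> A \<inter> \<Union>\<W>"
      then obtain W where W: "W \<in> \<W>" "x \<in> A \<inter> W" by blast
      then obtain n V where "n < d" "V \<in> \<V> W n" "x \<in> V" using \<V> by blast
      then show "x \<in> (\<Union>n<d. \<Union>(\<Union>W\<in>\<W>. (\<inter>) W ` \<V> W n))" using W by blast
    qed
  qed
qed

lemma disjoint_refinements_separated_UN:
  assumes open_G: "\<And>i. i \<in> I \<Longrightarrow> openin X (G i)"
    and disj: "\<And>i j. i \<in> I \<Longrightarrow> j \<in> I \<Longrightarrow> i \<noteq> j \<Longrightarrow> disjnt (G i) (G j)"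
    and AG: "\<And>i. i \<in> I \<Longrightarrow> A i \<subseteq> G i"
    and ref: "\<And>i. i \<in> I \<Longrightarrow> disjoint_refinements X d \<U> (A i)"
  shows "disjoint_refinements X d \<U> (\<Union>i\<in>I. A i)"
proof -
  have "disjoint_open_refinement X {topspace X} (G ` I)"
  proof (rule disjoint_open_refinementI)
    fix V W assume "V \<in> G ` I" "W \<in> G ` I" "V \<noteq> W"
    then show "disjnt V W" using disj by blast
  qed (use open_G openin_subset in auto)
  moreover have "disjoint_refinements X d \<U> ((\<Union>i\<in>I. A i) \<inter> G j)" if j: "j \<in> I" for j
  proof (rule disjoint_refinements_subset[OF ref[OF j]])
    show "(\<Union>i\<in>I. A i) \<inter> G j \<subseteq> A j" using AG disj[OF _ j] by (fastforce simp: disjnt_iff)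
  qed
  ultimately have "disjoint_refinements X d \<U> ((\<Union>i\<in>I. A i) \<inter> \<Union>(G ` I))"
    by (intro disjoint_refinements_disjoint_UN) auto
  then show ?thesis by (rule disjoint_refinements_subset) (use AG in blast)
qed

lemma disjoint_refinements_split:
  assumes ref: "disjoint_refinements X d (\<lambda>_. (\<lambda>n. \<Union>(\<D> n)) ` M) A"
    and \<D>: "\<And>n. n \<in> M \<Longrightarrow> disjoint_open_refinement X \<U> (\<D> n)"
  shows "disjoint_refinements X d (\<lambda>_. \<U>) A"
proof -
  obtain \<V> where \<V>: "\<And>i. i < d \<Longrightarrow> disjoint_open_refinement X ((\<lambda>n. \<Union>(\<D> n)) ` M) (\<V> i)"
      "A \<subseteq> (\<Union>i<d. \<Union>(\<V> i))"
    by (rule disjoint_refinementsE[OF ref]) (rule that)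
  define s where "s V = (SOME n. n \<in> M \<and> V \<subseteq> \<Union>(\<D> n))" for V
  have s: "s V \<in> M" "V \<subseteq> \<Union>(\<D> (s V))" if "i < d" "V \<in> \<V> i" for i V
  proof -
    have "\<exists>n. n \<in> M \<and> V \<subseteq> \<Union>(\<D> n)"
      using disjoint_open_refinementD(3)[OF \<V>(1)[OF that(1)] that(2)] by blast
    then have "s V \<in> M \<and> V \<subseteq> \<Union>(\<D> (s V))" unfolding s_def by (rule someI_ex)
    then show "s V \<in> M" "V \<subseteq> \<Union>(\<D> (s V))" by auto
  qed
  show ?thesis
  proof (rule disjoint_refinementsI)
    show "disjoint_open_refinement X \<U> (\<Union>V\<in>\<V> i. (\<inter>) V ` \<D> (s V))" if "i < d" for i
      using s(1)[OF that] by (intro disjoint_open_refinement_Int[OF \<V>(1)[OF that]] \<D>)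
    show "A \<subseteq> (\<Union>i<d. \<Union>(\<Union>V\<in>\<V> i. (\<inter>) V ` \<D> (s V)))"
    proof
      fix x assume "x \<in> A"
      then obtain i V where V: "i < d" "V \<in> \<V> i" "x \<in> V" using \<V>(2) by blast
      then obtain D where "D \<in> \<D> (s V)" "x \<in> D" using s(2)[OF V(1,2)] by blast
      then show "x \<in> (\<Union>i<d. \<Union>(\<Union>V\<in>\<V> i. (\<inter>) V ` \<D> (s V)))" using V by blast
    qed
  qed
qed

section \<open>Dominant sets\<close>

context bump_family
begin

definition dominant_set :: "'i set \<Rightarrow> 'a set" where
  "dominant_set J = {x \<in> topspace X. \<forall>i\<in>J. 0 < u i x \<and> (\<forall>j\<in>I - J. u j x < u i x)}"

definition dominant_family :: "nat \<Rightarrow> 'a set set" where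
  "dominant_family n = dominant_set ` {J. J \<subseteq> I \<and> finite J \<and> card J = Suc n}"

lemma openin_dominant_set:
  assumes J: "J \<subseteq> I" "finite J"
  shows "openin X (dominant_set J)"
proof (subst openin_subopen, intro ballI)
  fix x assume x: "x \<in> dominant_set J"
  then have "x \<in> topspace X" by (simp add: dominant_set_def)
  then obtain N where N: "openin X N" "x \<in> N" and fin: "finite {i\<in>I. \<exists>y\<in>N. u i y \<noteq> 0}"
    by (rule finite_local_support)
  define F where "F = {i\<in>I. \<exists>y\<in>N. u i y \<noteq> 0}"
  let ?T = "{x \<in> topspace X. \<forall>i\<in>J. 0 < u i x} \<inter> {x \<in> topspace X. \<forall>i\<in>J. \<forall>j\<in>F - J. u j x < u i x}"
  have "openin X {x \<in> topspace X. \<forall>i\<in>J. 0 < u i x}"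
    using J continuous by (intro openin_Collect_finite_ball openin_Collect_less) auto
  moreover have "openin X {x \<in> topspace X. \<forall>i\<in>J. \<forall>j\<in>F - J. u j x < u i x}"
    using J continuous fin unfolding F_def
    by (intro openin_Collect_finite_ball openin_Collect_less) auto
  ultimately have "openin X (N \<inter> ?T)" using N by auto
  moreover have "x \<in> N \<inter> ?T"
    using x N by (auto simp: dominant_set_def F_def)
  moreover have "N \<inter> ?T \<subseteq> dominant_set J"
  proof
    fix y assume y: "y \<in> N \<inter> ?T"
    have "u j y < u i y" if "i \<in> J" "j \<in> I - J" for i j
    proof (cases "j \<in> F")
      case True then show ?thesis using y that by blast
    next
      case False
      then have "u j y = 0" using y that by (auto simp: F_def)
      then show ?thesis using y that by auto
    qed
    then show "y \<in> dominant_set J" using y by (auto simp: dominant_set_def)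
  qed
  ultimately show "\<exists>T. openin X T \<and> x \<in> T \<and> T \<subseteq> dominant_set J" by blast
qed

lemma dominant_set_subset:
  assumes "J \<subseteq> I" "i \<in> J"
  shows "dominant_set J \<subseteq> U i"
  using assms subordinate[of i] by (force simp: dominant_set_def)

lemma disjnt_dominant_set:
  assumes "J \<subseteq> I" "K \<subseteq> I" "finite J" "finite K" "card J = card K" "J \<noteq> K"
  shows "disjnt (dominant_set J) (dominant_set K)"
proof -
  obtain i where i: "i \<in> J - K"
    using assms by (metis Diff_eq_empty_iff all_not_in_conv card_subset_eq)
  obtain j where j: "j \<in> K - J"
    using assms by (metis Diff_eq_empty_iff all_not_in_conv card_subset_eq)
  have False if "x \<in> dominant_set J" "x \<in> dominant_set K" for x
  proof -
    have "u j x < u i x" "u i x < u j x"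
      using that i j assms unfolding dominant_set_def by blast+
    then show False by simp
  qed
  then show ?thesis by (auto simp: disjnt_iff)
qed

lemma mem_dominant_set_peaks:
  assumes "x \<in> topspace X"
  shows "x \<in> dominant_set (peaks x)"
proof -
  have "u j x < 1" if "j \<in> I - peaks x" for j
    using le_one[OF _ assms, of j] that by (force simp: peaks_def)
  then show ?thesis using assms by (auto simp: dominant_set_def peaks_def)
qed

lemma dominant_family_disjoint_open_refinement:
  "disjoint_open_refinement X \<V> {D \<in> dominant_family n. \<exists>V\<in>\<V>. D \<subseteq> V}"
proof (rule disjoint_open_refinementI)
  fix S T assume "S \<in> {D \<in> dominant_family n. \<exists>V\<in>\<V>. D \<subseteq> V}"
    "T \<in> {D \<in> dominant_family n. \<exists>V\<in>\<V>. D \<subseteq> V}"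
    "S \<noteq> T"
  then obtain J K where "S = dominant_set J" "J \<subseteq> I" "finite J" "card J = Suc n"
      "T = dominant_set K" "K \<subseteq> I" "finite K" "card K = Suc n" "J \<noteq> K"
    unfolding dominant_family_def by auto
  then show "disjnt S T" by (simp add: disjnt_dominant_set)
qed (auto simp: dominant_family_def openin_dominant_set)

lemma disjoint_refinements_of_peaks:
  assumes A: "A \<subseteq> topspace X" and n: "\<And>x. x \<in> A \<Longrightarrow> card (peaks x) \<le> n"
    and refines: "\<And>x. x \<in> A \<Longrightarrow> \<exists>i\<in>peaks x. \<exists>V\<in>\<V>. U i \<subseteq> V"
  shows "disjoint_refinements X n (\<lambda>_. \<V>) A"
proof (rule disjoint_refinementsI[OF dominant_family_disjoint_open_refinement])
  show "A \<subseteq> (\<Union>k<n. \<Union>{D \<in> dominant_family k. \<exists>V\<in>\<V>. D \<subseteq> V})"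
  proof
    fix x assume xA: "x \<in> A"
    then have x: "x \<in> topspace X" using A by blast
    obtain k where k: "card (peaks x) = Suc k"
      using finite_peaks[OF x] peaks_nonempty[OF x] by (metis card_0_eq not0_implies_Suc)
    obtain i V where V: "i \<in> peaks x" "V \<in> \<V>" "U i \<subseteq> V" using refines[OF xA] by blast
    have "peaks x \<subseteq> I" by (auto simp: peaks_def)
    then have "dominant_set (peaks x) \<subseteq> V" "dominant_set (peaks x) \<in> dominant_family k"
      using dominant_set_subset[of "peaks x" i] V finite_peaks[OF x] k
      by (auto simp: dominant_family_def)
    then show "x \<in> (\<Union>k<n. \<Union>{D \<in> dominant_family k. \<exists>V\<in>\<V>. D \<subseteq> V})"
      using mem_dominant_set_peaks[OF x] n[OF xA] k V(2) by (intro UN_I[of k] UnionI) auto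
  qed
qed

end

section \<open>Inessential families of pairs of closed sets\<close>

definition disjoint_closed_pair :: "'a topology \<Rightarrow> 'a set \<Rightarrow> 'a set \<Rightarrow> bool" where
  "disjoint_closed_pair X C D \<longleftrightarrow> closedin X C \<and> closedin X D \<and> disjnt C D"

text \<open>Only the traces on \<open>A\<close> have to be separated, so that pairs on disjoint sets can be glued.\<close>
definition inessential ::
    "'a topology \<Rightarrow> 'i set \<Rightarrow> ('i \<Rightarrow> 'a set) \<Rightarrow> ('i \<Rightarrow> 'a set) \<Rightarrow> 'a set \<Rightarrow> bool" where
  "inessential X I C D A \<longleftrightarrow>
     (\<exists>V W. (\<forall>i\<in>I. openin X (V i) \<and> openin X (W i) \<and> disjnt (V i) (W i) \<and>
                 C i \<inter> A \<subseteq> V i \<and> D i \<inter> A \<subseteq> W i) \<and>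
            A \<subseteq> (\<Union>i\<in>I. V i \<union> W i))"

text \<open>By the theorem on partitions, for \<open>A = topspace X\<close> normal this says that the covering dimension
  is at most \<open>d - 1\<close>.\<close>
definition separating_dim :: "'a topology \<Rightarrow> nat \<Rightarrow> 'a set \<Rightarrow> bool" where
  "separating_dim X d A \<longleftrightarrow>
     (\<forall>C D. (\<forall>i<d. disjoint_closed_pair X (C i) (D i)) \<longrightarrow> inessential X {..<d} C D A)"

lemma inessentialI:
  assumes "\<And>i. i \<in> I \<Longrightarrow> openin X (V i)" "\<And>i. i \<in> I \<Longrightarrow> openin X (W i)" "\<And>i. i \<in> I \<Longrightarrow> disjnt (V i) (W i)"
    "\<And>i. i \<in> I \<Longrightarrow> C i \<inter> A \<subseteq> V i" "\<And>i. i \<in> I \<Longrightarrow> D i \<inter> A \<subseteq> W i" "A \<subseteq> (\<Union>i\<in>I. V i \<union> W i)"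
  shows "inessential X I C D A"
  unfolding inessential_def by (rule exI[of _ V], rule exI[of _ W]) (use assms in simp)

lemma inessentialE:
  assumes "inessential X I C D A"
  obtains V W where "\<And>i. i \<in> I \<Longrightarrow> openin X (V i)" "\<And>i. i \<in> I \<Longrightarrow> openin X (W i)"
    "\<And>i. i \<in> I \<Longrightarrow> disjnt (V i) (W i)" "\<And>i. i \<in> I \<Longrightarrow> C i \<inter> A \<subseteq> V i" "\<And>i. i \<in> I \<Longrightarrow> D i \<inter> A \<subseteq> W i"
    "A \<subseteq> (\<Union>i\<in>I. V i \<union> W i)"
proof -
  obtain V W
    where "\<forall>i\<in>I. openin X (V i) \<and> openin X (W i) \<and> disjnt (V i) (W i) \<and> C i \<inter> A \<subseteq> V i \<and> D i \<inter> A \<subseteq> W i"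
    "A \<subseteq> (\<Union>i\<in>I. V i \<union> W i)"
    using assms unfolding inessential_def by (elim exE conjE)
  then show ?thesis by (intro that[of V W]) simp_all
qed

lemma inessential_restrict:
  assumes "inessential X I C D A" "B \<subseteq> A"
    and "\<And>i. i \<in> I \<Longrightarrow> C' i \<inter> B \<subseteq> C i" "\<And>i. i \<in> I \<Longrightarrow> D' i \<inter> B \<subseteq> D i"
  shows "inessential X I C' D' B"
proof -
  obtain V W where VW: "\<And>i. i \<in> I \<Longrightarrow> openin X (V i)" "\<And>i. i \<in> I \<Longrightarrow> openin X (W i)"
    "\<And>i. i \<in> I \<Longrightarrow> disjnt (V i) (W i)"
    and traces: "\<And>i. i \<in> I \<Longrightarrow> C i \<inter> A \<subseteq> V i" "\<And>i. i \<in> I \<Longrightarrow> D i \<inter> A \<subseteq> W i"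
    and cover: "A \<subseteq> (\<Union>i\<in>I. V i \<union> W i)"
    by (rule inessentialE[OF assms(1)]) (rule that)
  have "C' i \<inter> B \<subseteq> V i" "D' i \<inter> B \<subseteq> W i" if "i \<in> I" for i
    using traces[OF that] assms(2) assms(3,4)[OF that] by blast+
  then show ?thesis
    using VW order_trans[OF assms(2) cover] by (intro inessentialI[where V=V and W=W])
qed

lemma separating_dim_subset:
  assumes "separating_dim X d A" "B \<subseteq> A"
  shows "separating_dim X d B"
  using assms inessential_restrict[OF _ assms(2)] unfolding separating_dim_def by blast

lemma separating_dim_inessential:
  assumes sep: "separating_dim X d A" and T: "finite T" "card T = d"
    and pairs: "\<And>i. i \<in> T \<Longrightarrow> disjoint_closed_pair X (C i) (D i)"
  shows "inessential X T C D A"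
proof -
  obtain h where h: "bij_betw h {..<d} T"
    using ex_bij_betw_nat_finite[OF T(1)] T(2) by (auto simp: atLeast0LessThan)
  then have "disjoint_closed_pair X (C (h n)) (D (h n))" if "n < d" for n
    using pairs bij_betwE that by blast
  then have "inessential X {..<d} (\<lambda>n. C (h n)) (\<lambda>n. D (h n)) A"
    using sep unfolding separating_dim_def by simp
  then obtain V W where VW: "\<And>n. n \<in> {..<d} \<Longrightarrow> openin X (V n)" "\<And>n. n \<in> {..<d} \<Longrightarrow> openin X (W n)"
    "\<And>n. n \<in> {..<d} \<Longrightarrow> disjnt (V n) (W n)" "\<And>n. n \<in> {..<d} \<Longrightarrow> C (h n) \<inter> A \<subseteq> V n"
    "\<And>n. n \<in> {..<d} \<Longrightarrow> D (h n) \<inter> A \<subseteq> W n" and cover: "A \<subseteq> (\<Union>n\<in>{..<d}. V n \<union> W n)"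
    by (rule inessentialE) (rule that)
  define k where "k = inv_into {..<d} h"
  have k: "k i \<in> {..<d}" "h (k i) = i" if "i \<in> T" for i
    using that h inv_into_into[of i h] f_inv_into_f[of i h] unfolding k_def bij_betw_def by auto
  have k_image: "{..<d} = k ` T"
    using bij_betw_inv_into[OF h] unfolding k_def bij_betw_def by blast
  have "A \<subseteq> (\<Union>i\<in>T. V (k i) \<union> W (k i))" using cover unfolding k_image by simp
  then show ?thesis
    using k VW(1-3)[OF k(1)] VW(4,5)[OF k(1)]
    by (intro inessentialI[where V="\<lambda>i. V (k i)" and W="\<lambda>i. W (k i)"]) auto
qed

definition open_shrinking :: "'a topology \<Rightarrow> 'i set \<Rightarrow> ('i \<Rightarrow> 'a set) \<Rightarrow> ('i \<Rightarrow> 'a set) \<Rightarrow> bool" where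
  "open_shrinking X I U U' \<longleftrightarrow> indexed_open_cover X I U' \<and> (\<forall>i\<in>I. U' i \<subseteq> U i)"

lemma inessential_shrink_intersections:
  assumes A: "closedin X A" and U: "indexed_open_cover X I U" and S: "S \<subseteq> I"
    and Z: "indexed_open_cover X I Z" "\<And>i. i \<in> I \<Longrightarrow> X closure_of (Z i) \<subseteq> U i"
    and inessential: "inessential X S (\<lambda>i. X closure_of (Z i)) (\<lambda>i. topspace X - U i) A"
  shows "\<exists>U'. open_shrinking X I U U' \<and> (\<forall>t\<in>I - S. A \<inter> (\<Inter>i\<in>insert t S. U' i) = {})"
proof -
  obtain V W where open_VW: "\<And>i. i \<in> S \<Longrightarrow> openin X (V i)" "\<And>i. i \<in> S \<Longrightarrow> openin X (W i)"
    and disj: "\<And>i. i \<in> S \<Longrightarrow> disjnt (V i) (W i)"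
    and traces: "\<And>i. i \<in> S \<Longrightarrow> X closure_of (Z i) \<inter> A \<subseteq> V i"
      "\<And>i. i \<in> S \<Longrightarrow> (topspace X - U i) \<inter> A \<subseteq> W i"
    and cover: "A \<subseteq> (\<Union>i\<in>S. V i \<union> W i)"
    by (rule inessentialE[OF inessential]) (rule that)
  define U' where "U' i = U i \<inter> ((if i \<in> S then V i else \<Union>(W ` S)) \<union> (topspace X - A))" for i
  have "\<exists>i\<in>I. x \<in> U' i" if x: "x \<in> topspace X" for x
  proof -
    obtain i where i: "i \<in> I" "x \<in> Z i" using Z(1) x unfolding indexed_open_cover_def by blast
    then have xZ: "x \<in> X closure_of (Z i)"
      using indexed_open_cover_subset_closure[OF Z(1)] by blast
    then have xU: "x \<in> U i" using Z(2)[OF i(1)] by blast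
    consider "x \<notin> A" | "x \<in> A" "i \<in> S" | n where "x \<in> A" "i \<notin> S" "n \<in> S" "x \<in> W n"
      | n where "x \<in> A" "n \<in> S" "x \<in> V n" "x \<notin> W n"
      using cover by blast
    then show ?thesis
    proof cases
      case (4 n)
      then have "x \<in> U n" using traces(2)[of n] x by auto
      then show ?thesis using 4 S by (auto simp: U'_def)
    qed (use i(1) x xU xZ traces(1)[of i] in \<open>auto simp: U'_def\<close>)
  qed
  moreover have "openin X (U' i)" if "i \<in> I" for i
  proof -
    have "openin X (\<Union>(W ` S))" using open_VW(2) by auto
    then have "openin X (if i \<in> S then V i else \<Union>(W ` S))" using open_VW(1) by simp
    then show ?thesis
      unfolding U'_def using that U A
      by (intro openin_Int openin_Un openin_diff) (auto simp: indexed_open_cover_def)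
  qed
  ultimately have "open_shrinking X I U U'"
    by (auto simp: open_shrinking_def indexed_open_cover_def U'_def)
  moreover have "x \<notin> (\<Inter>i\<in>S. U' i)" if "t \<in> I - S" "x \<in> A" "x \<in> U' t" for t x
    using that disj by (auto simp: U'_def disjnt_iff)
  then have "A \<inter> (\<Inter>i\<in>insert t S. U' i) = {}" if "t \<in> I - S" for t using that by auto
  ultimately show ?thesis by blast
qed

lemma separating_dim_shrink_intersection:
  assumes paracompact: "paracompact_space X" and sep: "separating_dim X d A" and A: "closedin X A"
    and U: "indexed_open_cover X I U" and T: "T \<subseteq> I" "card T = Suc d"
  shows "\<exists>U'. open_shrinking X I U U' \<and> A \<inter> (\<Inter>i\<in>T. U' i) = {}"
proof -
  obtain t where t: "t \<in> T" using T(2) by fastforce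
  define S where "S = T - {t}"
  have "finite T" using T(2) by (intro card_ge_0_finite) simp
  then have S: "finite S" "card S = d" "S \<subseteq> I" "insert t S = T" "t \<in> I - S"
    using T t by (auto simp: S_def)
  obtain Z where Z: "indexed_open_cover X I Z" "\<And>i. i \<in> I \<Longrightarrow> X closure_of (Z i) \<subseteq> U i"
    by (rule paracompact_space_shrinking[OF paracompact U]) (rule that)
  have "disjoint_closed_pair X (X closure_of (Z i)) (topspace X - U i)" if "i \<in> S" for i
    using U Z(2)[of i] subsetD[OF S(3) that]
    by (auto simp: disjoint_closed_pair_def disjnt_iff indexed_open_cover_def)
  then have "inessential X S (\<lambda>i. X closure_of (Z i)) (\<lambda>i. topspace X - U i) A"
    by (rule separating_dim_inessential[OF sep S(1,2)])
  from inessential_shrink_intersections[OF A U S(3) Z this] show ?thesis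
    using S(4,5) by blast
qed

lemma separating_dim_shrink_intersections:
  assumes paracompact: "paracompact_space X" and sep: "separating_dim X d A" and A: "closedin X A"
    and "finite \<T>" "\<And>T. T \<in> \<T> \<Longrightarrow> T \<subseteq> I \<and> card T = Suc d" "indexed_open_cover X I U"
  shows "\<exists>U'. open_shrinking X I U U' \<and> (\<forall>T\<in>\<T>. A \<inter> (\<Inter>i\<in>T. U' i) = {})"
  using assms(4-)
proof (induction \<T>)
  case empty
  then show ?case by (auto simp: open_shrinking_def)
next
  case (insert T \<T>)
  then obtain U' where U': "open_shrinking X I U U'" "\<forall>S\<in>\<T>. A \<inter> (\<Inter>i\<in>S. U' i) = {}"
    by auto
  then have "indexed_open_cover X I U'" by (simp add: open_shrinking_def)
  then obtain U'' where U'': "open_shrinking X I U' U''" "A \<inter> (\<Inter>i\<in>T. U'' i) = {}"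
    using separating_dim_shrink_intersection[OF paracompact sep A _ _, of I U' T]
      insert.prems(1)[of T]
    by auto
  have "A \<inter> (\<Inter>i\<in>S. U'' i) = {}" if "S \<in> \<T>" for S
  proof -
    have "S \<subseteq> I" using insert.prems(1) that by blast
    then have "(\<Inter>i\<in>S. U'' i) \<subseteq> (\<Inter>i\<in>S. U' i)"
      using U''(1) by (intro INF_mono) (auto simp: open_shrinking_def)
    moreover have "A \<inter> (\<Inter>i\<in>S. U' i) = {}" using U'(2) that by (rule bspec)
    ultimately show ?thesis by (meson disjoint_iff subsetD)
  qed
  moreover have "open_shrinking X I U U''"
    using U''(1) U'(1) unfolding open_shrinking_def by blast
  ultimately show ?case using U''(2) by blast
qed

lemma separating_dim_finite_cover:
  assumes paracompact: "paracompact_space X" and sep: "separating_dim X d A" and A: "closedin X A"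
    and \<U>: "finite \<U>" "\<And>U. U \<in> \<U> \<Longrightarrow> openin X U" "A \<subseteq> \<Union>\<U>"
  shows "disjoint_refinements X d (\<lambda>_. \<U>) A"
proof -
  define I where "I = insert (topspace X - A) \<U>"
  have "open_cover X I" using \<U>(2,3) A by (intro open_coverI) (auto simp: I_def)
  then have "indexed_open_cover X I (\<lambda>U. U)" by (simp add: indexed_open_cover_ident)
  moreover have "finite {T. T \<subseteq> I \<and> card T = Suc d}" using \<U>(1) by (simp add: I_def)
  ultimately have "\<exists>U'. open_shrinking X I (\<lambda>U. U) U' \<and>
      (\<forall>T\<in>{T. T \<subseteq> I \<and> card T = Suc d}. A \<inter> (\<Inter>i\<in>T. U' i) = {})"
    by (intro separating_dim_shrink_intersections[OF paracompact sep A]) auto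
  then obtain U' where U': "indexed_open_cover X I U'" "\<And>U. U \<in> I \<Longrightarrow> U' U \<subseteq> U"
    and empty: "\<And>T. T \<subseteq> I \<Longrightarrow> card T = Suc d \<Longrightarrow> A \<inter> (\<Inter>i\<in>T. U' i) = {}"
    by (auto simp: open_shrinking_def)
  obtain u where "bump_family X I U' u"
    by (rule paracompact_space_bump_family[OF paracompact U'(1)])
  then interpret bump_family X I U' u .
  show ?thesis
  proof (rule disjoint_refinements_of_peaks)
    show A_subset: "A \<subseteq> topspace X" using A by (rule closedin_subset)
    fix x assume xA: "x \<in> A"
    then have x: "x \<in> topspace X" using A_subset by blast
    show "card (peaks x) \<le> d"
    proof (rule ccontr)
      assume "\<not> ?thesis"
      then have "Suc d \<le> card (peaks x)" by simp
      then obtain T where T: "T \<subseteq> peaks x" "card T = Suc d" by (rule obtain_subset_with_card_n)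
      then have "x \<in> (\<Inter>i\<in>T. U' i)" "T \<subseteq> I" using peak_subordinate[OF x] by blast+
      then show False using empty[OF _ T(2)] xA by blast
    qed
    obtain U where U: "U \<in> peaks x" using peaks_nonempty[OF x] by blast
    then have "U \<in> I" "x \<in> U" using peak_subordinate[OF x U] U'(2) by blast+
    then have "U \<in> \<U>" using xA by (auto simp: I_def)
    then show "\<exists>U\<in>peaks x. \<exists>V\<in>\<U>. U' U \<subseteq> V" using U U'(2)[OF \<open>U \<in> I\<close>] by blast
  qed
qed

lemma separating_dim_reduce_refinements:
  assumes paracompact: "paracompact_space X" and sep: "separating_dim X d A" and A: "closedin X A"
    and ref: "disjoint_refinements X n (\<lambda>_. \<U>) A"
  shows "disjoint_refinements X d (\<lambda>_. \<U>) A"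
proof -
  obtain \<V> where \<V>: "\<And>k. k < n \<Longrightarrow> disjoint_open_refinement X \<U> (\<V> k)" "A \<subseteq> (\<Union>k<n. \<Union>(\<V> k))"
    by (rule disjoint_refinementsE[OF ref]) (rule that)
  then have "disjoint_refinements X d (\<lambda>_. (\<lambda>k. \<Union>(\<V> k)) ` {..<n}) A"
    by (intro separating_dim_finite_cover[OF paracompact sep A])
       (auto dest: disjoint_open_refinementD(2))
  then show ?thesis by (rule disjoint_refinements_split) (simp add: \<V>(1))
qed

lemma normal_space_separate_pair_covering:
  assumes normal: "normal_space X" and CD: "disjoint_closed_pair X C D"
    and F: "closedin X F" "F \<subseteq> \<Union>\<V>"
    and \<V>: "disjoint_open_refinement X {topspace X - C, topspace X - D} \<V>"
  shows "\<exists>V W. openin X V \<and> openin X W \<and> disjnt V W \<and> C \<subseteq> V \<and> D \<subseteq> W \<and> F \<subseteq> V \<union> W"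
proof -
  define P where "P = \<Union>{V\<in>\<V>. V \<inter> C \<noteq> {}}"
  define Q where "Q = \<Union>{V\<in>\<V>. V \<inter> C = {}}"
  have PQ: "disjnt P Q"
    using disjoint_open_refinementD(1)[OF \<V>] unfolding P_def Q_def disjnt_def by blast
  have "openin X P" "openin X Q"
    using disjoint_open_refinementD(2)[OF \<V>] by (auto simp: P_def Q_def)
  moreover have "closedin X C" "closedin X D" using CD by (auto simp: disjoint_closed_pair_def)
  ultimately have "closedin X (C \<union> (F - Q))" "closedin X (D \<union> (F - P))"
    using F(1) by auto
  moreover have "\<Union>\<V> = P \<union> Q" unfolding P_def Q_def by blast
  then have "F \<subseteq> P \<union> Q" using F(2) by simp
  moreover have "P \<inter> D = {}" "Q \<inter> C = {}"
    using disjoint_open_refinementD(3)[OF \<V>] unfolding P_def Q_def by blast+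
  then have "disjnt (C \<union> (F - Q)) (D \<union> (F - P))"
    using CD PQ \<open>F \<subseteq> P \<union> Q\<close> by (auto simp: disjoint_closed_pair_def disjnt_iff)
  ultimately obtain V W where "openin X V" "openin X W" "C \<union> (F - Q) \<subseteq> V" "D \<union> (F - P) \<subseteq> W"
    "disjnt V W"
    using normal unfolding normal_space_def by meson
  then show ?thesis using PQ by (intro exI[of _ V] exI[of _ W]) (auto simp: disjnt_iff)
qed

lemma finite_C_space_refinements:
  assumes "finite_C_space X" "\<And>n. finite_open_cover X (\<U> n)"
  shows "\<exists>k. disjoint_refinements X k \<U> (topspace X)"
proof -
  obtain k \<V> where "\<forall>n\<le>k. (\<forall>V\<in>\<V> n. openin X V \<and> (\<exists>U\<in>\<U> n. V \<subseteq> U)) \<and> pairwise disjnt (\<V> n)"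
    "(\<Union>n\<le>k. \<Union>(\<V> n)) = topspace X"
    using assms(1)[unfolded finite_C_space_def, THEN conjunct2, THEN spec, of \<U>] assms(2) by auto
  then have "disjoint_refinements X (Suc k) \<U> (topspace X)"
    by (intro disjoint_refinementsI[where \<V>=\<V>])
       (simp_all add: disjoint_open_refinement_def less_Suc_eq_le lessThan_Suc_atMost)
  then show ?thesis ..
qed

lemma finite_C_space_inessential:
  assumes paracompact: "paracompact_space X" and finite_C: "finite_C_space X"
    and CD: "\<And>n::nat. disjoint_closed_pair X (C n) (D n)"
  shows "\<exists>k. inessential X {..<k} C D (topspace X)"
proof -
  have "finite_open_cover X {topspace X - C n, topspace X - D n}" for n
    using CD[of n] by (auto simp: finite_open_cover_def disjoint_closed_pair_def disjnt_iff)
  then obtain k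
    where "disjoint_refinements X k (\<lambda>n. {topspace X - C n, topspace X - D n}) (topspace X)"
    using finite_C_space_refinements[OF finite_C, of "\<lambda>n. {topspace X - C n, topspace X - D n}"]
    by blast
  then obtain \<V>
    where \<V>: "\<And>n. n < k \<Longrightarrow> disjoint_open_refinement X {topspace X - C n, topspace X - D n} (\<V> n)"
    and "topspace X \<subseteq> (\<Union>n<k. \<Union>(\<V> n))"
    by (rule disjoint_refinementsE) (rule that)
  then have "indexed_open_cover X {..<k} (\<lambda>n. \<Union>(\<V> n))"
    by (auto simp: indexed_open_cover_def dest: disjoint_open_refinementD(2))
  then obtain Z where Z: "indexed_open_cover X {..<k} Z"
    "\<And>n. n \<in> {..<k} \<Longrightarrow> X closure_of Z n \<subseteq> \<Union>(\<V> n)"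
    by (rule paracompact_space_shrinking[OF paracompact]) (rule that)
  have "\<exists>V W. openin X V \<and> openin X W \<and> disjnt V W \<and> C n \<subseteq> V \<and> D n \<subseteq> W \<and> X closure_of Z n \<subseteq> V \<union> W"
    if "n < k" for n
    using that Z(2)[of n]
    by (intro normal_space_separate_pair_covering[OF paracompact_imp_normal_space CD _ _ \<V>] paracompact)
       auto
  then obtain V W where VW: "\<And>n. n < k \<Longrightarrow> openin X (V n) \<and> openin X (W n) \<and> disjnt (V n) (W n) \<and>
      C n \<subseteq> V n \<and> D n \<subseteq> W n \<and> X closure_of Z n \<subseteq> V n \<union> W n"
    by metis
  have "Z n \<subseteq> V n \<union> W n" if "n < k" for n
    using VW[OF that] indexed_open_cover_subset_closure[OF Z(1), of n] that by auto
  then have "topspace X \<subseteq> (\<Union>n\<in>{..<k}. V n \<union> W n)"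
    using Z(1) unfolding indexed_open_cover_def by blast
  then have "inessential X {..<k} C D (topspace X)"
    by (intro inessentialI[where V=V and W=W]) (simp_all add: VW le_infI1)
  then show ?thesis ..
qed

section \<open>Refinable sets\<close>

definition refinable :: "'a topology \<Rightarrow> nat \<Rightarrow> 'a set \<Rightarrow> bool" where
  "refinable X d A \<longleftrightarrow> (\<forall>\<U>. open_cover X \<U> \<longrightarrow> disjoint_refinements X d (\<lambda>_. \<U>) A)"

lemma refinable_subset:
  assumes "refinable X d A" "B \<subseteq> A"
  shows "refinable X d B"
  using assms disjoint_refinements_subset unfolding refinable_def by blast

lemma refinable_mono:
  assumes "refinable X d A" "d \<le> e"
  shows "refinable X e A"
  using assms disjoint_refinements_mono unfolding refinable_def by blast

lemma refinable_Un:
  assumes "refinable X d A" "refinable X e B"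
  shows "refinable X (d + e) (A \<union> B)"
  using assms unfolding refinable_def by (intro allI impI disjoint_refinements_Un) auto

lemma refinable_of_refinable_pieces:
  assumes "disjoint_refinements X n (\<lambda>_. {W. refinable X d W}) A"
  shows "refinable X (n * d) A"
  unfolding refinable_def
proof (intro allI impI)
  fix \<U> assume \<U>: "open_cover X \<U>"
  obtain \<W> where \<W>: "\<And>k. k < n \<Longrightarrow> disjoint_open_refinement X {W. refinable X d W} (\<W> k)"
      "A \<subseteq> (\<Union>k<n. \<Union>(\<W> k))"
    by (rule disjoint_refinementsE[OF assms]) (rule that)
  have "disjoint_refinements X d (\<lambda>_. \<U>) (A \<inter> \<Union>(\<W> k))" if k: "k < n" for k
  proof (rule disjoint_refinements_disjoint_UN[OF \<W>(1)[OF k]])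
    fix W assume "W \<in> \<W> k"
    then obtain W' where "refinable X d W'" "W \<subseteq> W'"
      using disjoint_open_refinementD(3)[OF \<W>(1)[OF k]] by blast
    then show "disjoint_refinements X d (\<lambda>_. \<U>) (A \<inter> W)"
      using \<U> refinable_subset[of X d W' "A \<inter> W"] by (auto simp: refinable_def)
  qed
  then have "disjoint_refinements X (n * d) (\<lambda>_. \<U>) (\<Union>k<n. A \<inter> \<Union>(\<W> k))"
    by (rule disjoint_refinements_UN_lessThan)
  then show "disjoint_refinements X (n * d) (\<lambda>_. \<U>) A"
    by (rule disjoint_refinements_subset) (use \<W>(2) in blast)
qed

lemma refinable_sequence_of_covers:
  assumes ref: "refinable X d A" and \<U>: "\<And>n. open_cover X (\<U> n)"
  shows "disjoint_refinements X d \<U> A"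
proof -
  define \<C> where "\<C> = {V. openin X V \<and> (\<forall>n<d. \<exists>U\<in>\<U> n. V \<subseteq> U)}"
  have "open_cover X \<C>"
  proof (rule open_coverI)
    fix x assume x: "x \<in> topspace X"
    then have "\<forall>n. \<exists>U\<in>\<U> n. x \<in> U" using \<U> unfolding open_cover_def by blast
    then obtain U where U: "\<And>n. U n \<in> \<U> n" "\<And>n. x \<in> U n" by metis
    have "openin X ((\<Inter>n\<in>{..<d}. U n) \<inter> topspace X)"
      using U(1) \<U> by (intro openin_INT) (auto simp: open_cover_def)
    then have "(\<Inter>n\<in>{..<d}. U n) \<inter> topspace X \<in> \<C>"
      using U(1) unfolding \<C>_def by blast
    then show "\<exists>V\<in>\<C>. x \<in> V" by (rule bexI[rotated]) (use U(2) x in simp)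
  qed (simp add: \<C>_def)
  then have "disjoint_refinements X d (\<lambda>_. \<C>) A" using ref by (simp add: refinable_def)
  then obtain \<V> where \<V>: "\<And>n. n < d \<Longrightarrow> disjoint_open_refinement X \<C> (\<V> n)" "A \<subseteq> (\<Union>n<d. \<Union>(\<V> n))"
    by (rule disjoint_refinementsE) (rule that)
  have "disjoint_open_refinement X (\<U> n) (\<V> n)" if "n < d" for n
    using disjoint_open_refinement_trans[OF \<V>(1)[OF that], of "\<U> n"] that by (auto simp: \<C>_def)
  then show ?thesis using \<V>(2) by (rule disjoint_refinementsI)
qed

definition strip :: "'a topology \<Rightarrow> ('a \<Rightarrow> real) \<Rightarrow> nat \<Rightarrow> 'a set" where
  "strip X f n = {x \<in> topspace X. real n \<le> f x \<and> f x \<le> real n + 1}"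

lemma closedin_strip:
  assumes "continuous_map X euclideanreal f"
  shows "closedin X (strip X f n)"
  using closedin_continuous_map_preimage[OF assms, of "{real n..real n + 1}"]
  by (simp add: strip_def)

lemma disjoint_refinements_superlevel:
  assumes f: "continuous_map X euclideanreal f"
    and ref: "\<And>n. N \<le> n \<Longrightarrow> disjoint_refinements X d (\<lambda>_. \<U>) (A \<inter> strip X f n)"
  shows "disjoint_refinements X (2 * d) (\<lambda>_. \<U>) (A \<inter> {x \<in> topspace X. real N \<le> f x})"
proof -
  define wide where
    "wide n = {x \<in> topspace X. real n - 1/2 < f x} \<inter> {x \<in> topspace X. f x < real n + 3/2}" for n :: nat
  define S where "S c = {n. N \<le> n \<and> n mod 2 = c}" for c
  define B where "B c = (\<Union>n\<in>S c. A \<inter> strip X f n)" for c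
  have open_wide: "openin X (wide n)" for n
    unfolding wide_def using f by (intro openin_Int openin_Collect_less) auto
  have disjnt_wide: "disjnt (wide n) (wide m)" if "n \<in> S c" "m \<in> S c" "n \<noteq> m" for n m c
  proof -
    have "n mod 2 = m mod 2" using that by (simp add: S_def)
    then have "m \<noteq> Suc n" "n \<noteq> Suc m" by (auto simp: mod_Suc split: if_splits)
    then have "n + 2 \<le> m \<or> m + 2 \<le> n" using \<open>n \<noteq> m\<close> by linarith
    then show ?thesis by (auto simp: disjnt_iff wide_def)
  qed
  have "disjoint_refinements X d (\<lambda>_. \<U>) (B c)" for c
    unfolding B_def
  proof (rule disjoint_refinements_separated_UN[OF open_wide disjnt_wide])
    show "A \<inter> strip X f n \<subseteq> wide n" for n by (auto simp: strip_def wide_def)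
  qed (use ref in \<open>simp_all add: S_def\<close>)
  then have "disjoint_refinements X (2 * d) (\<lambda>_. \<U>) (\<Union>c<2. B c)"
    by (rule disjoint_refinements_UN_lessThan)
  then show ?thesis
  proof (rule disjoint_refinements_subset, intro subsetI)
    fix x assume x: "x \<in> A \<inter> {x \<in> topspace X. real N \<le> f x}"
    define n where "n = nat \<lfloor>f x\<rfloor>"
    have "0 \<le> f x" using x by (auto intro: order_trans[OF of_nat_0_le_iff])
    then have "x \<in> strip X f n" using x by (simp add: strip_def n_def)
    moreover have "N \<le> n" using x by (simp add: n_def le_nat_floor)
    ultimately show "x \<in> (\<Union>c<2. B c)"
      using x by (intro UN_I[of "n mod 2"]) (auto simp: B_def S_def)
  qed
qed

lemma separating_dim_imp_refinable:
  assumes paracompact: "paracompact_space X" and sep: "separating_dim X d A" and A: "closedin X A"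
  shows "refinable X (2 * d) A"
  unfolding refinable_def
proof (intro allI impI)
  fix \<U> assume "open_cover X \<U>"
  then have "indexed_open_cover X \<U> (\<lambda>U. U)" by (simp add: indexed_open_cover_ident)
  then obtain u where "bump_family X \<U> (\<lambda>U. U) u"
    by (rule paracompact_space_bump_family[OF paracompact])
  then interpret bump_family X \<U> "\<lambda>U. U" u .
  define f where "f = weighted_sum (\<lambda>_. 1)"
  have f: "continuous_map X euclideanreal f" unfolding f_def by (rule continuous_map_weighted_sum)
  have card_peaks: "real (card (peaks x)) \<le> f x" if "x \<in> topspace X" for x
    unfolding f_def by (rule card_peaks_le_weighted_sum[OF that]) simp
  have "disjoint_refinements X d (\<lambda>_. \<U>) (A \<inter> strip X f n)" for n
  proof (rule separating_dim_reduce_refinements[OF paracompact])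
    show "separating_dim X d (A \<inter> strip X f n)" by (rule separating_dim_subset[OF sep]) simp
    show "closedin X (A \<inter> strip X f n)" using A closedin_strip[OF f] by blast
    show "disjoint_refinements X (Suc n) (\<lambda>_. \<U>) (A \<inter> strip X f n)"
    proof (rule disjoint_refinements_of_peaks)
      fix x assume "x \<in> A \<inter> strip X f n"
      then have x: "x \<in> topspace X" "f x \<le> real n + 1" by (auto simp: strip_def)
      then have "real (card (peaks x)) \<le> real (Suc n)" using card_peaks[OF x(1)] by simp
      then show "card (peaks x) \<le> Suc n" by (simp only: of_nat_le_iff)
      show "\<exists>U\<in>peaks x. \<exists>V\<in>\<U>. U \<subseteq> V"
        using peaks_nonempty[OF x(1)] peak_subordinate(1)[OF x(1)] by blast
    qed (auto simp: strip_def)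
  qed
  then have "disjoint_refinements X (2 * d) (\<lambda>_. \<U>) (A \<inter> {x \<in> topspace X. real 0 \<le> f x})"
    by (rule disjoint_refinements_superlevel[OF f])
  moreover have "0 \<le> f x" if "x \<in> topspace X" for x
    using card_peaks[OF that] by (rule order_trans[OF of_nat_0_le_iff])
  ultimately show "disjoint_refinements X (2 * d) (\<lambda>_. \<U>) A"
    using closedin_subset[OF A] by (elim disjoint_refinements_subset) auto
qed

section \<open>Arbitrary open covers of finite C-spaces\<close>

text \<open>A family of \<open>d\<close> pairs that is essential on \<open>A d\<close>, for every \<open>d\<close>, would glue to a sequence of
  pairs of which no initial segment is inessential.\<close>
lemma finite_C_space_separating_dim_locally_finite:
  assumes paracompact: "paracompact_space X" and finite_C: "finite_C_space X"
    and loc_finite: "locally_finite_family X UNIV A" and closed: "\<And>d::nat. closedin X (A d)"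
    and disj: "\<And>d e. d \<noteq> e \<Longrightarrow> disjnt (A d) (A e)"
  shows "\<exists>d. separating_dim X d (A d)"
proof (rule ccontr)
  assume "\<not> ?thesis"
  then have "\<forall>d. \<exists>C D. (\<forall>i<d. disjoint_closed_pair X (C i) (D i)) \<and> \<not> inessential X {..<d} C D (A d)"
    unfolding separating_dim_def by simp
  then obtain C D where pairs: "\<And>d i. i < d \<Longrightarrow> disjoint_closed_pair X (C d i) (D d i)"
    and essential: "\<And>d. \<not> inessential X {..<d} (C d) (D d) (A d)"
    by metis
  define C' where "C' i = (\<Union>d\<in>{i<..}. C d i \<inter> A d)" for i
  define D' where "D' i = (\<Union>d\<in>{i<..}. D d i \<inter> A d)" for i
  have "disjoint_closed_pair X (C' i) (D' i)" for i
    unfolding disjoint_closed_pair_def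
  proof (intro conjI)
    have closed_UN: "closedin X (\<Union>d\<in>{i<..}. E d \<inter> A d)" if "\<And>d. i < d \<Longrightarrow> closedin X (E d)" for E
    proof (rule closedin_UN_locally_finite_family)
      show "locally_finite_family X {i<..} (\<lambda>d. E d \<inter> A d)"
        by (rule locally_finite_family_subsets[OF loc_finite]) auto
      show "closedin X (E d \<inter> A d)" if "d \<in> {i<..}" for d
        using closed that \<open>\<And>d. i < d \<Longrightarrow> closedin X (E d)\<close> by auto
    qed
    show "closedin X (C' i)" "closedin X (D' i)"
      unfolding C'_def D'_def using pairs by (auto simp: disjoint_closed_pair_def intro: closed_UN)
    show "disjnt (C' i) (D' i)"
      unfolding disjnt_iff
    proof (intro allI notI)
      fix x assume "x \<in> C' i \<and> x \<in> D' i"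
      then obtain d e where d: "i < d" "x \<in> C d i" "x \<in> A d" and e: "x \<in> D e i" "x \<in> A e"
        unfolding C'_def D'_def by blast
      then have "d = e" using disj[of d e] by (auto simp: disjnt_iff)
      then show False using pairs[OF d(1)] d(2) e(1)
        by (auto simp: disjoint_closed_pair_def disjnt_iff)
    qed
  qed
  then obtain k where k: "inessential X {..<k} C' D' (topspace X)"
    using finite_C_space_inessential[OF paracompact finite_C, of C' D'] by blast
  have "inessential X {..<k} (C k) (D k) (A k)"
    by (rule inessential_restrict[OF k closedin_subset[OF closed]]) (auto simp: C'_def D'_def)
  then show False using essential by blast
qed

lemma finite_C_space_separating_dim_strips:
  assumes paracompact: "paracompact_space X" and finite_C: "finite_C_space X"
    and f: "continuous_map X euclideanreal f"
  shows "\<exists>N d. \<forall>n\<ge>N. separating_dim X d (strip X f n)"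
proof (rule ccontr)
  assume "\<not> ?thesis"
  then have ex_not_sep: "\<exists>n\<ge>N. \<not> separating_dim X d (strip X f n)" for N d by blast
  have "\<exists>p. \<forall>d. \<not> separating_dim X d (strip X f (p d)) \<and> p d + 2 \<le> p (Suc d)"
    using ex_not_sep by (intro dependent_nat_choice) blast+
  then obtain p where not_sep: "\<And>d. \<not> separating_dim X d (strip X f (p d))"
    and step: "\<And>d. p d + 2 \<le> p (Suc d)" by blast
  have "\<exists>d. separating_dim X d (strip X f (p d))"
  proof (rule finite_C_space_separating_dim_locally_finite[OF paracompact finite_C])
    have "p d < p (Suc d)" for d using step[of d] by simp
    then have "strict_mono p" by (simp add: strict_mono_Suc_iff)
    then have p_ge: "d \<le> p d" for d by (rule strict_mono_imp_increasing)
    have gap: "p d + 2 \<le> p e" if "d < e" for d e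
      using step[of d] strict_mono_less_eq[OF \<open>strict_mono p\<close>, of "Suc d" e] that by linarith
    show "disjnt (strip X f (p d)) (strip X f (p e))" if "d \<noteq> e" for d e
      using gap[of d e] gap[of e d] that
      by (cases d e rule: linorder_cases) (auto simp: disjnt_iff strip_def)
    show "locally_finite_family X UNIV (\<lambda>d. strip X f (p d))"
      unfolding locally_finite_family_def
    proof
      fix x assume x: "x \<in> topspace X"
      let ?N = "{y \<in> topspace X. f y < f x + 1}"
      have "d \<le> nat \<lceil>f x + 1\<rceil>" if "strip X f (p d) \<inter> ?N \<noteq> {}" for d
      proof -
        have "real (p d) < f x + 1" using that by (auto simp: strip_def)
        then show ?thesis using p_ge[of d] by linarith
      qed
      then have "{d \<in> UNIV. strip X f (p d) \<inter> ?N \<noteq> {}} \<subseteq> {..nat \<lceil>f x + 1\<rceil>}" by auto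
      then have "finite {d \<in> UNIV. strip X f (p d) \<inter> ?N \<noteq> {}}" by (rule finite_subset) simp
      moreover have "openin X ?N" using f by (intro openin_Collect_less) auto
      ultimately show "\<exists>N. openin X N \<and> x \<in> N \<and> finite {d \<in> UNIV. strip X f (p d) \<inter> N \<noteq> {}}"
        using x by (intro exI[of _ ?N]) simp
    qed
  qed (rule closedin_strip[OF f])
  then show False using not_sep by blast
qed

lemma finite_C_space_refinable_superlevel:
  assumes paracompact: "paracompact_space X" and finite_C: "finite_C_space X"
    and f: "continuous_map X euclideanreal f"
  shows "\<exists>N d. refinable X d {x \<in> topspace X. real N \<le> f x}"
proof -
  obtain N d where "\<And>n. N \<le> n \<Longrightarrow> separating_dim X d (strip X f n)"
    using finite_C_space_separating_dim_strips[OF paracompact finite_C f] by blast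
  then have strips: "refinable X (2 * d) (strip X f n)" if "N \<le> n" for n
    using that by (intro separating_dim_imp_refinable[OF paracompact] closedin_strip[OF f])
  have "disjoint_refinements X (2 * (2 * d)) (\<lambda>_. \<U>) (UNIV \<inter> {x \<in> topspace X. real N \<le> f x})"
    if "open_cover X \<U>" for \<U>
    using strips that by (intro disjoint_refinements_superlevel[OF f]) (simp add: refinable_def)
  then show ?thesis unfolding refinable_def by auto
qed

definition unrefinable_core :: "'a topology \<Rightarrow> 'a set" where
  "unrefinable_core X = {x \<in> topspace X. \<nexists>W d. openin X W \<and> x \<in> W \<and> refinable X d W}"

lemma closedin_unrefinable_core: "closedin X (unrefinable_core X)"
proof -
  have "topspace X - unrefinable_core X = \<Union>{W. openin X W \<and> (\<exists>d. refinable X d W)}"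
    unfolding unrefinable_core_def by (auto dest: openin_subset)
  then have "openin X (topspace X - unrefinable_core X)" by auto
  then show ?thesis by (auto simp: closedin_def unrefinable_core_def)
qed

text \<open>A function that is unbounded on the core would contradict that its superlevel sets are
  eventually refinable.\<close>
lemma unrefinable_core_finite_subcover:
  assumes paracompact: "paracompact_space X" and finite_C: "finite_C_space X"
    and \<U>: "open_cover X \<U>"
  shows "\<exists>\<F>. finite \<F> \<and> \<F> \<subseteq> \<U> \<and> unrefinable_core X \<subseteq> \<Union>\<F>"
proof -
  obtain u where "bump_family X \<U> (\<lambda>U. U) u"
    using paracompact_space_bump_family[OF paracompact, of \<U> "\<lambda>U. U"] \<U>
    by (auto simp: indexed_open_cover_ident)
  then interpret bump_family X \<U> "\<lambda>U. U" u .
  have core: "x \<in> topspace X" if "x \<in> unrefinable_core X" for x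
    using that by (simp add: unrefinable_core_def)
  define \<F> where "\<F> = (\<Union>x\<in>unrefinable_core X. peaks x)"
  have "\<F> \<subseteq> \<U>" by (auto simp: \<F>_def peaks_def)
  moreover have "x \<in> \<Union>\<F>" if x: "x \<in> unrefinable_core X" for x
  proof -
    obtain U where "U \<in> peaks x" using peaks_nonempty[OF core[OF x]] by blast
    then show ?thesis using peak_subordinate(2)[OF core[OF x]] x unfolding \<F>_def by blast
  qed
  moreover have "finite \<F>"
  proof (rule ccontr)
    assume "infinite \<F>"
    then obtain h :: "nat \<Rightarrow> 'a set" where h: "inj h" "range h \<subseteq> \<F>"
      using infinite_countable_subset by blast
    define c where "c U = (if U \<in> range h then real (inv h U) else 0)" for U
    obtain N d where N: "refinable X d {x \<in> topspace X. real N \<le> weighted_sum c x}"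
      using finite_C_space_refinable_superlevel[OF paracompact finite_C continuous_map_weighted_sum]
      by blast
    obtain x where x: "x \<in> unrefinable_core X" "h (Suc N) \<in> peaks x"
      using h(2) unfolding \<F>_def by blast
    have "c (h (Suc N)) \<le> weighted_sum c x"
      by (rule peak_le_weighted_sum[OF core[OF x(1)] _ x(2)]) (simp add: c_def)
    then have "real (Suc N) \<le> weighted_sum c x" using h(1) by (simp add: c_def)
    let ?W = "{x \<in> topspace X. real N < weighted_sum c x}"
    have "openin X ?W" using continuous_map_weighted_sum by (intro openin_Collect_less) auto
    moreover have "x \<in> ?W" using \<open>real (Suc N) \<le> weighted_sum c x\<close> core[OF x(1)] by simp
    moreover have "refinable X d ?W" by (rule refinable_subset[OF N]) auto
    ultimately show False using x(1) unfolding unrefinable_core_def by blast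
  qed
  ultimately show ?thesis by blast
qed

text \<open>The weighted sum bounds both the number of peaks at a point and their refinement numbers.\<close>
lemma (in bump_family) refinable_of_weighted_sum_le:
  assumes A: "A \<subseteq> topspace X" and ref: "\<And>i. i \<in> I \<Longrightarrow> U i \<inter> A \<noteq> {} \<Longrightarrow> refinable X (\<delta> i) (U i)"
    and bound: "\<And>x. x \<in> A \<Longrightarrow> weighted_sum (\<lambda>i. 1 + real (\<delta> i)) x \<le> real n"
  shows "refinable X (n * n) A"
proof -
  have "disjoint_refinements X n (\<lambda>_. {W. refinable X n W}) A"
  proof (rule disjoint_refinements_of_peaks[OF A])
    fix x assume xA: "x \<in> A"
    then have x: "x \<in> topspace X" using A by blast
    have "real (card (peaks x)) \<le> weighted_sum (\<lambda>i. 1 + real (\<delta> i)) x"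
      by (rule card_peaks_le_weighted_sum[OF x]) simp
    then show "card (peaks x) \<le> n" using bound[OF xA] by linarith
    obtain i where i: "i \<in> peaks x" using peaks_nonempty[OF x] by blast
    have "1 + real (\<delta> i) \<le> weighted_sum (\<lambda>i. 1 + real (\<delta> i)) x"
      by (rule peak_le_weighted_sum[OF x _ i]) simp
    then have "\<delta> i \<le> n" using bound[OF xA] by linarith
    moreover have "refinable X (\<delta> i) (U i)"
      using ref peak_subordinate[OF x i] xA by blast
    ultimately have "refinable X n (U i)" by (rule refinable_mono[rotated])
    then show "\<exists>i\<in>peaks x. \<exists>V\<in>{W. refinable X n W}. U i \<subseteq> V" using i by blast
  qed
  then show ?thesis by (rule refinable_of_refinable_pieces)
qed

lemma refinable_off_unrefinable_core:
  assumes paracompact: "paracompact_space X" and finite_C: "finite_C_space X"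
    and A: "closedin X A" "disjnt A (unrefinable_core X)"
  shows "\<exists>d. refinable X d A"
proof -
  define \<U> where "\<U> = insert (topspace X - A) {W. openin X W \<and> (\<exists>d. refinable X d W)}"
  have "open_cover X \<U>"
  proof (rule open_coverI)
    show "\<exists>U\<in>\<U>. x \<in> U" if "x \<in> topspace X" for x
    proof (cases "x \<in> A")
      case True
      then have "x \<notin> unrefinable_core X" using A(2) by (auto simp: disjnt_iff)
      then obtain W d where "openin X W" "x \<in> W" "refinable X d W"
        using \<open>x \<in> topspace X\<close> unfolding unrefinable_core_def by blast
      then show ?thesis unfolding \<U>_def by blast
    qed (use that in \<open>auto simp: \<U>_def\<close>)
  qed (use A(1) in \<open>auto simp: \<U>_def\<close>)
  then obtain u where "bump_family X \<U> (\<lambda>U. U) u"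
    using paracompact_space_bump_family[OF paracompact, of \<U> "\<lambda>U. U"]
    by (auto simp: indexed_open_cover_ident)
  then interpret bump_family X \<U> "\<lambda>U. U" u .
  have "\<exists>d. refinable X d W" if "W \<in> \<U>" "W \<inter> A \<noteq> {}" for W
    using that by (auto simp: \<U>_def)
  then obtain \<delta> where \<delta>: "\<And>W. W \<in> \<U> \<Longrightarrow> W \<inter> A \<noteq> {} \<Longrightarrow> refinable X (\<delta> W) W"
    by metis
  let ?f = "weighted_sum (\<lambda>W. 1 + real (\<delta> W))"
  obtain N d where superlevel: "refinable X d {x \<in> topspace X. real N \<le> ?f x}"
    using finite_C_space_refinable_superlevel[OF paracompact finite_C continuous_map_weighted_sum]
    by blast
  have A_subset: "A \<subseteq> topspace X" using A(1) by (rule closedin_subset)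
  then have "refinable X (N * N) {x\<in>A. ?f x \<le> real N}"
    using \<delta> by (intro refinable_of_weighted_sum_le[of _ \<delta>]) blast+
  then have "refinable X (N * N + d) ({x\<in>A. ?f x \<le> real N} \<union> {x \<in> topspace X. real N \<le> ?f x})"
    using superlevel by (rule refinable_Un)
  then have "refinable X (N * N + d) A" by (rule refinable_subset) (use A_subset in auto)
  then show ?thesis ..
qed

lemma unrefinable_core_refinements:
  assumes paracompact: "paracompact_space X" and finite_C: "finite_C_space X"
    and \<U>: "\<And>n. open_cover X (\<U> n)"
  shows "\<exists>k W. openin X W \<and> unrefinable_core X \<subseteq> W \<and> disjoint_refinements X k \<U> W"
proof -
  have "\<exists>\<F>. finite \<F> \<and> \<F> \<subseteq> \<U> n \<and> unrefinable_core X \<subseteq> \<Union>\<F>" for n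
    using unrefinable_core_finite_subcover[OF paracompact finite_C \<U>] .
  then obtain \<F> where \<F>: "\<And>n. finite (\<F> n)" "\<And>n. \<F> n \<subseteq> \<U> n" "\<And>n. unrefinable_core X \<subseteq> \<Union>(\<F> n)"
    by metis
  let ?\<G> = "\<lambda>n. insert (topspace X - unrefinable_core X) (\<F> n)"
  have "finite_open_cover X (?\<G> n)" for n
  proof -
    have "openin X U" if "U \<in> ?\<G> n" for U
      using that \<F>(2)[of n] \<U>[of n] closedin_unrefinable_core[of X] by (auto simp: open_cover_def)
    then have "open_cover X (?\<G> n)" using \<F>(3)[of n] by (intro open_coverI) auto
    then show ?thesis using \<F>(1) by (simp add: open_cover_def finite_open_cover_def)
  qed
  then obtain k where "disjoint_refinements X k ?\<G> (topspace X)"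
    using finite_C_space_refinements[OF finite_C, of ?\<G>] by blast
  then obtain \<V> where \<V>: "\<And>n. n < k \<Longrightarrow> disjoint_open_refinement X (?\<G> n) (\<V> n)"
    and cover: "topspace X \<subseteq> (\<Union>n<k. \<Union>(\<V> n))"
    by (rule disjoint_refinementsE) (rule that)
  define \<W> where "\<W> n = {V\<in>\<V> n. V \<inter> unrefinable_core X \<noteq> {}}" for n
  have \<W>: "disjoint_open_refinement X (\<U> n) (\<W> n)" if n: "n < k" for n
  proof (rule disjoint_open_refinementI)
    show "\<exists>U\<in>\<U> n. V \<subseteq> U" if "V \<in> \<W> n" for V
      using that disjoint_open_refinementD(3)[OF \<V>[OF n], of V] \<F>(2)[of n] unfolding \<W>_def by blast
  qed (use disjoint_open_refinementD(1,2)[OF \<V>[OF n]] in \<open>auto simp: \<W>_def\<close>)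
  have "openin X (\<Union>n<k. \<Union>(\<W> n))" using disjoint_open_refinementD(2)[OF \<W>] by blast
  moreover have "unrefinable_core X \<subseteq> (\<Union>n<k. \<Union>(\<W> n))"
  proof
    fix x assume x: "x \<in> unrefinable_core X"
    then have "x \<in> topspace X" by (simp add: unrefinable_core_def)
    then obtain n V where "n < k" "V \<in> \<V> n" "x \<in> V" using cover by blast
    then show "x \<in> (\<Union>n<k. \<Union>(\<W> n))" using x unfolding \<W>_def by blast
  qed
  moreover have "disjoint_refinements X k \<U> (\<Union>n<k. \<Union>(\<W> n))"
    by (rule disjoint_refinementsI[where \<V>=\<W>]) (simp_all add: \<W>)
  ultimately show ?thesis by blast
qed

lemma finite_C_space_open_covers:
  assumes paracompact: "paracompact_space X" and finite_C: "finite_C_space X"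
    and \<U>: "\<And>n. open_cover X (\<U> n)"
  shows "\<exists>k. disjoint_refinements X k \<U> (topspace X)"
proof -
  obtain k W where W: "openin X W" "unrefinable_core X \<subseteq> W" "disjoint_refinements X k \<U> W"
    using unrefinable_core_refinements[OF paracompact finite_C, of \<U>] \<U> by blast
  then obtain d where "refinable X d (topspace X - W)"
    using refinable_off_unrefinable_core[OF paracompact finite_C, of "topspace X - W"]
    by (auto simp: disjnt_iff)
  then have "disjoint_refinements X d (\<lambda>n. \<U> (k + n)) (topspace X - W)"
    using \<U> by (intro refinable_sequence_of_covers)
  with W(3) have "disjoint_refinements X (k + d) \<U> (W \<union> (topspace X - W))"
    by (rule disjoint_refinements_Un)
  then show ?thesis using disjoint_refinements_subset by blast
qed

section \<open>The Whitehead topology and cones\<close>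

abbreviation simplex_topology :: "'v set \<Rightarrow> ('v \<Rightarrow> real) topology" where
  "simplex_topology \<sigma> \<equiv> subtopology (powertop_real UNIV) (geom_simplex \<sigma>)"

lemma openin_whitehead_topology:
  "openin (whitehead_topology \<Sigma>) U \<longleftrightarrow> U \<subseteq> realization \<Sigma> \<and>
      (\<forall>\<sigma>\<in>\<Sigma>. openin (simplex_topology \<sigma>) (U \<inter> geom_simplex \<sigma>))"
proof -
  have "istopology (\<lambda>U. U \<subseteq> realization \<Sigma> \<and>
      (\<forall>\<sigma>\<in>\<Sigma>. openin (simplex_topology \<sigma>) (U \<inter> geom_simplex \<sigma>)))"
    unfolding istopology_def
  proof (intro conjI allI impI ballI)
    fix S T \<sigma> assume ST: "S \<subseteq> realization \<Sigma> \<and> (\<forall>\<sigma>\<in>\<Sigma>. openin (simplex_topology \<sigma>) (S \<inter> geom_simplex \<sigma>))"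
      "T \<subseteq> realization \<Sigma> \<and> (\<forall>\<sigma>\<in>\<Sigma>. openin (simplex_topology \<sigma>) (T \<inter> geom_simplex \<sigma>))" "\<sigma> \<in> \<Sigma>"
    have "(S \<inter> geom_simplex \<sigma>) \<inter> (T \<inter> geom_simplex \<sigma>) = S \<inter> T \<inter> geom_simplex \<sigma>" by blast
    then show "openin (simplex_topology \<sigma>) (S \<inter> T \<inter> geom_simplex \<sigma>)"
      using ST openin_Int[of "simplex_topology \<sigma>" "S \<inter> geom_simplex \<sigma>" "T \<inter> geom_simplex \<sigma>"] by simp
  next
    fix \<K> \<sigma> assume \<K>: "\<forall>K\<in>\<K>. K \<subseteq> realization \<Sigma> \<and>
        (\<forall>\<sigma>\<in>\<Sigma>. openin (simplex_topology \<sigma>) (K \<inter> geom_simplex \<sigma>))"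
      "\<sigma> \<in> \<Sigma>"
    have "(\<Union>K\<in>\<K>. K \<inter> geom_simplex \<sigma>) = \<Union>\<K> \<inter> geom_simplex \<sigma>" by blast
    then show "openin (simplex_topology \<sigma>) (\<Union>\<K> \<inter> geom_simplex \<sigma>)"
      using \<K> openin_Union[of "(\<lambda>K. K \<inter> geom_simplex \<sigma>) ` \<K>" "simplex_topology \<sigma>"] by auto
  qed blast+
  then show ?thesis unfolding whitehead_topology_def by simp
qed

lemma topspace_whitehead_topology: "topspace (whitehead_topology \<Sigma>) = realization \<Sigma>"
proof
  show "topspace (whitehead_topology \<Sigma>) \<subseteq> realization \<Sigma>"
    using openin_topspace[of "whitehead_topology \<Sigma>"] unfolding openin_whitehead_topology by blast
  have "openin (simplex_topology \<sigma>) (realization \<Sigma> \<inter> geom_simplex \<sigma>)" if "\<sigma> \<in> \<Sigma>" for \<sigma>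
  proof -
    have "realization \<Sigma> \<inter> geom_simplex \<sigma> = geom_simplex \<sigma>"
      using that by (auto simp: realization_def)
    then show ?thesis using openin_topspace[of "simplex_topology \<sigma>"] by simp
  qed
  then have "openin (whitehead_topology \<Sigma>) (realization \<Sigma>)"
    unfolding openin_whitehead_topology by simp
  then show "realization \<Sigma> \<subseteq> topspace (whitehead_topology \<Sigma>)" by (rule openin_subset)
qed

lemma continuous_map_whitehead_topology:
  "continuous_map (whitehead_topology \<Sigma>) Y g \<longleftrightarrow> (\<forall>\<sigma>\<in>\<Sigma>. continuous_map (simplex_topology \<sigma>) Y g)"
proof -
  have preimage: "{\<alpha> \<in> realization \<Sigma>. g \<alpha> \<in> U} \<inter> geom_simplex \<sigma> = {\<alpha> \<in> geom_simplex \<sigma>. g \<alpha> \<in> U}"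
    if "\<sigma> \<in> \<Sigma>" for \<sigma> U
    using that by (auto simp: realization_def)
  have "g \<in> realization \<Sigma> \<rightarrow> topspace Y \<longleftrightarrow> (\<forall>\<sigma>\<in>\<Sigma>. g \<in> geom_simplex \<sigma> \<rightarrow> topspace Y)"
    by (auto simp: realization_def)
  then show ?thesis
    by (auto simp: continuous_map_def topspace_whitehead_topology openin_whitehead_topology preimage
        simp flip: ball_conj_distrib)
qed

lemma continuous_map_into_simplex_imp_whitehead:
  assumes f: "continuous_map X (simplex_topology \<sigma>) f" and \<sigma>: "\<sigma> \<in> \<Sigma>"
  shows "continuous_map X (whitehead_topology \<Sigma>) f"
proof -
  have "continuous_map (simplex_topology \<sigma>) (whitehead_topology \<Sigma>) id"
    using \<sigma> continuous_map_id[of "whitehead_topology \<Sigma>"] unfolding continuous_map_whitehead_topology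
    by blast
  then have "continuous_map X (whitehead_topology \<Sigma>) (id \<circ> f)"
    by (rule continuous_map_compose[OF f])
  then show ?thesis by simp
qed

definition null_homotopy ::
    "'a topology \<Rightarrow> 'b topology \<Rightarrow> ('a \<Rightarrow> 'b) \<Rightarrow> 'b \<Rightarrow> (real \<times> 'a \<Rightarrow> 'b) \<Rightarrow> bool" where
  "null_homotopy Z Y g c H \<longleftrightarrow> c \<in> topspace Y \<and>
     continuous_map (prod_topology (top_of_set {0..1}) Z) Y H \<and>
     (\<forall>z. H (0, z) = g z) \<and> (\<forall>z\<in>topspace Z. H (1, z) = c)"

lemma hook_omega_null_homotopy:
  fixes \<Sigma> :: "'v set set"
  assumes hook: "hook_omega TYPE('v) m S T" and T: "T \<noteq> {}" "T \<subseteq> mspace m"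
    and \<Sigma>: "simplicial_complex \<Sigma>" "finite_dimensional \<Sigma>"
    and g: "continuous_map (whitehead_topology \<Sigma>) (subtopology (mtopology_of m) S) g"
  shows "\<exists>c H. null_homotopy (whitehead_topology \<Sigma>) (subtopology (mtopology_of m) T) g c H"
proof -
  let ?Z = "whitehead_topology \<Sigma>" and ?T = "subtopology (mtopology_of m) T"
  obtain c where "homotopic_with (\<lambda>h. True) ?Z ?T g (\<lambda>_. c)"
    using hook \<Sigma> g unfolding hook_omega_def by blast
  then obtain H where H: "continuous_map (prod_topology (top_of_set {0..1::real}) ?Z) ?T H"
      "\<And>z. H (0, z) = g z" "\<And>z. H (1, z) = c"
    unfolding homotopic_with_def by blast
  \<comment> \<open>over an empty complex the constant \<open>c\<close> need not lie in \<open>T\<close>\<close>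
  show ?thesis
  proof (cases "topspace ?Z = {}")
    case True
    obtain t where "t \<in> topspace ?T" using T by auto
    then show ?thesis using H True by (auto simp: null_homotopy_def)
  next
    case False
    then obtain z where "z \<in> topspace ?Z" by blast
    then have "(1, z) \<in> topspace (prod_topology (top_of_set {0..1::real}) ?Z)" by simp
    then have "H (1, z) \<in> topspace ?T"
      using continuous_map_image_subset_topspace[OF H(1)] by blast
    then show ?thesis using H by (auto simp: null_homotopy_def)
  qed
qed

definition face_projection :: "'v \<Rightarrow> ('v \<Rightarrow> real) \<Rightarrow> 'v \<Rightarrow> real" where
  "face_projection v \<alpha> = (\<lambda>w. if w = v then 0 else \<alpha> w / (1 - \<alpha> v))"

lemma face_projection_eq_self: "\<alpha> v = 0 \<Longrightarrow> face_projection v \<alpha> = \<alpha>"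
  by (auto simp: face_projection_def)

lemma face_projection_geom_simplex:
  assumes "finite \<tau>" "v \<notin> \<tau>" "\<alpha> \<in> geom_simplex (insert v \<tau>)" "\<alpha> v < 1"
  shows "face_projection v \<alpha> \<in> geom_simplex \<tau>"
proof -
  have "sum (face_projection v \<alpha>) \<tau> = (\<Sum>w\<in>\<tau>. \<alpha> w / (1 - \<alpha> v))"
    using assms(2) by (intro sum.cong) (auto simp: face_projection_def)
  also have "\<dots> = sum \<alpha> \<tau> / (1 - \<alpha> v)" by (rule sum_divide_distrib[symmetric])
  also have "sum \<alpha> \<tau> = 1 - \<alpha> v" using assms by (simp add: geom_simplex_def)
  finally have "sum (face_projection v \<alpha>) \<tau> = 1" using assms(4) by simp
  then show ?thesis using assms by (auto simp: geom_simplex_def face_projection_def)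
qed

lemma continuous_map_barycentric_coordinate:
  "continuous_map (simplex_topology \<sigma>) euclideanreal (\<lambda>\<alpha>. \<alpha> v)"
  by (intro continuous_map_from_subtopology continuous_map_product_projection) simp

lemma continuous_map_face_projection:
  assumes "finite \<tau>" "v \<notin> \<tau>"
  shows "continuous_map (subtopology (simplex_topology (insert v \<tau>)) {\<alpha>. \<alpha> v < 1}) (simplex_topology \<tau>)
           (face_projection v)"
proof -
  let ?S = "subtopology (simplex_topology (insert v \<tau>)) {\<alpha>. \<alpha> v < 1}"
  have coord: "continuous_map ?S euclideanreal (\<lambda>\<alpha>. \<alpha> w)" for w
    by (rule continuous_map_from_subtopology[OF continuous_map_barycentric_coordinate])
  have "continuous_map ?S euclideanreal (\<lambda>\<alpha>. \<alpha> w / (1 - \<alpha> v))" for w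
    by (intro continuous_map_real_divide continuous_map_diff coord) auto
  then have "continuous_map ?S euclideanreal (\<lambda>\<alpha>. face_projection v \<alpha> w)" for w
    by (cases "w = v") (simp_all add: face_projection_def)
  then have "continuous_map ?S (powertop_real UNIV) (face_projection v)"
    by (simp add: continuous_map_componentwise_UNIV)
  then show ?thesis
    using face_projection_geom_simplex[OF assms] by (auto simp: continuous_map_in_subtopology)
qed

text \<open>The map is constant on the upper half of the cone, so that normalising the coordinates of the
  base by \<open>1 - \<alpha> v\<close> causes no trouble at the apex \<open>v\<close>.\<close>
definition cone_map :: "'v \<Rightarrow> 'b \<Rightarrow> (real \<times> ('v \<Rightarrow> real) \<Rightarrow> 'b) \<Rightarrow> ('v \<Rightarrow> real) \<Rightarrow> 'b" where
  "cone_map v c H \<alpha> = (if 1/2 \<le> \<alpha> v then c else H (2 * \<alpha> v, face_projection v \<alpha>))"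

lemma continuous_map_cone_map:
  assumes \<tau>: "finite \<tau>" "v \<notin> \<tau>" "\<tau> = {} \<or> \<tau> \<in> \<Sigma>"
    and null: "null_homotopy (whitehead_topology \<Sigma>) Y g c H"
  shows "continuous_map (simplex_topology (insert v \<tau>)) Y (cone_map v c H)"
proof (cases "\<tau> = {}")
  case True
  have "continuous_map (simplex_topology (insert v \<tau>)) Y (\<lambda>_. c)"
    using null by (simp add: null_homotopy_def)
  then show ?thesis
    by (rule continuous_map_eq) (use True in \<open>auto simp: cone_map_def geom_simplex_def\<close>)
next
  case False
  then have \<tau>\<Sigma>: "\<tau> \<in> \<Sigma>" using \<tau> by blast
  let ?X = "simplex_topology (insert v \<tau>)"
  let ?S = "subtopology ?X {\<alpha> \<in> topspace ?X. \<alpha> v \<le> 1/2}"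
  have "continuous_map ?S (simplex_topology \<tau>) (face_projection v)"
    by (rule continuous_map_from_subtopology_mono[OF continuous_map_face_projection[OF \<tau>(1,2)]]) auto
  then have "continuous_map ?S (whitehead_topology \<Sigma>) (face_projection v)"
    by (rule continuous_map_into_simplex_imp_whitehead[OF _ \<tau>\<Sigma>])
  moreover have "continuous_map ?S (top_of_set {0..1}) (\<lambda>\<alpha>. 2 * \<alpha> v)"
    unfolding continuous_map_in_subtopology
    by (intro conjI continuous_map_real_mult_left
          continuous_map_from_subtopology[OF continuous_map_barycentric_coordinate]) (auto simp: geom_simplex_def)
  ultimately have "continuous_map ?S (prod_topology (top_of_set {0..1}) (whitehead_topology \<Sigma>))
      (\<lambda>\<alpha>. (2 * \<alpha> v, face_projection v \<alpha>))"
    by (intro continuous_map_pairedI)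
  then have base: "continuous_map ?S Y (\<lambda>\<alpha>. H (2 * \<alpha> v, face_projection v \<alpha>))"
    using null continuous_map_compose unfolding null_homotopy_def o_def by blast
  have "continuous_map ?X Y (\<lambda>\<alpha>. if 1/2 \<le> \<alpha> v then c else H (2 * \<alpha> v, face_projection v \<alpha>))"
  proof (rule continuous_map_cases_le[OF _ continuous_map_barycentric_coordinate _ base])
    fix \<alpha> assume \<alpha>: "\<alpha> \<in> topspace ?X" "1/2 = \<alpha> v"
    then have "face_projection v \<alpha> \<in> geom_simplex \<tau>"
      by (intro face_projection_geom_simplex \<tau>) auto
    then have "face_projection v \<alpha> \<in> topspace (whitehead_topology \<Sigma>)"
      using \<tau>\<Sigma> by (auto simp: realization_def topspace_whitehead_topology)
    then show "c = H (2 * \<alpha> v, face_projection v \<alpha>)"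
      using null by (simp add: null_homotopy_def flip: \<alpha>(2))
  qed (use null in \<open>auto simp: null_homotopy_def\<close>)
  then show ?thesis unfolding cone_map_def .
qed

lemma simplicial_complex_face:
  assumes "simplicial_complex \<Sigma>" "\<sigma> \<in> \<Sigma>" "\<tau> \<subseteq> \<sigma>" "\<tau> \<noteq> {}"
  shows "\<tau> \<in> \<Sigma>"
  using assms unfolding simplicial_complex_def by blast

definition link :: "'v set set \<Rightarrow> 'v set set \<Rightarrow> 'v \<Rightarrow> 'v set set" where
  "link \<Sigma> K v = {\<tau>\<in>K. insert v \<tau> \<in> \<Sigma>}"

lemma simplicial_complex_link:
  assumes "simplicial_complex \<Sigma>" "simplicial_complex K"
  shows "simplicial_complex (link \<Sigma> K v)"
  unfolding simplicial_complex_def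
proof (intro ballI conjI allI impI)
  fix \<tau> assume \<tau>: "\<tau> \<in> link \<Sigma> K v"
  then have "\<tau> \<in> K" "insert v \<tau> \<in> \<Sigma>" by (simp_all add: link_def)
  then show "finite \<tau>" "\<tau> \<noteq> {}" using assms(2) unfolding simplicial_complex_def by blast+
  fix \<rho> assume \<rho>: "\<rho> \<subseteq> \<tau> \<and> \<rho> \<noteq> {}"
  then have "insert v \<rho> \<in> \<Sigma>"
    by (intro simplicial_complex_face[OF assms(1) \<open>insert v \<tau> \<in> \<Sigma>\<close>]) auto
  moreover have "\<rho> \<in> K" using \<rho> by (intro simplicial_complex_face[OF assms(2) \<open>\<tau> \<in> K\<close>]) auto
  ultimately show "\<rho> \<in> link \<Sigma> K v" by (simp add: link_def)
qed

definition cone_extension ::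
    "'v set \<Rightarrow> ('v \<Rightarrow> 'b) \<Rightarrow> ('v \<Rightarrow> real \<times> ('v \<Rightarrow> real) \<Rightarrow> 'b) \<Rightarrow> (('v \<Rightarrow> real) \<Rightarrow> 'b) \<Rightarrow> ('v \<Rightarrow> real) \<Rightarrow> 'b" where
  "cone_extension N c H g \<alpha> =
     (if \<exists>v\<in>N. 0 < \<alpha> v then let v = THE v. v \<in> N \<and> 0 < \<alpha> v in cone_map v (c v) (H v) \<alpha> else g \<alpha>)"

lemma cone_extension_off_vertices:
  assumes "\<alpha> \<in> geom_simplex \<sigma>" "\<sigma> \<inter> N = {}"
  shows "cone_extension N c H g \<alpha> = g \<alpha>"
proof -
  have "\<alpha> v = 0" if "v \<in> N" for v
    using assms that by (auto simp: geom_simplex_def)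
  then show ?thesis by (simp add: cone_extension_def)
qed

lemma cone_extension_eq_cone_map:
  assumes \<alpha>: "\<alpha> \<in> geom_simplex \<sigma>" and v: "\<sigma> \<inter> N = {v}" and H: "\<And>z. H v (0, z) = g z"
  shows "cone_extension N c H g \<alpha> = cone_map v (c v) (H v) \<alpha>"
proof -
  have unique: "w = v" if "w \<in> N" "0 < \<alpha> w" for w
  proof -
    have "w \<in> \<sigma>" using \<alpha> that(2) by (auto simp: geom_simplex_def)
    then show ?thesis using v that(1) by blast
  qed
  show ?thesis
  proof (cases "0 < \<alpha> v")
    case True
    then have "(THE v. v \<in> N \<and> 0 < \<alpha> v) = v" using v unique by (intro the_equality) auto
    then show ?thesis using True v by (auto simp: cone_extension_def)
  next
    case False
    then have "\<alpha> v = 0" using \<alpha> by (simp add: geom_simplex_def order_less_le)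
    moreover have "\<not> (\<exists>w\<in>N. 0 < \<alpha> w)" using unique False by blast
    ultimately show ?thesis by (simp add: cone_extension_def cone_map_def face_projection_eq_self H)
  qed
qed

definition carried_by ::
    "'b topology \<Rightarrow> ('v set \<Rightarrow> 'b set) \<Rightarrow> 'v set set \<Rightarrow> (('v \<Rightarrow> real) \<Rightarrow> 'b) \<Rightarrow> bool" where
  "carried_by Y F \<Sigma> g \<longleftrightarrow> (\<forall>\<sigma>\<in>\<Sigma>. continuous_map (simplex_topology \<sigma>) (subtopology Y (F \<sigma>)) g)"

lemma carried_by_cone_extension:
  assumes null: "\<And>v. v \<in> N \<Longrightarrow>
      null_homotopy (whitehead_topology (link \<Sigma> K v)) (subtopology Y (B v)) g (c v) (H v)"
    and off: "\<And>\<sigma>. \<sigma> \<in> \<Sigma> \<Longrightarrow> \<sigma> \<inter> N = {} \<Longrightarrow> continuous_map (simplex_topology \<sigma>) (subtopology Y (F \<sigma>)) g"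
    and on: "\<And>\<sigma> v. \<sigma> \<in> \<Sigma> \<Longrightarrow> v \<in> \<sigma> \<inter> N \<Longrightarrow>
      finite \<sigma> \<and> \<sigma> \<inter> N = {v} \<and> B v \<subseteq> F \<sigma> \<and> (\<sigma> - {v} = {} \<or> \<sigma> - {v} \<in> K)"
  shows "carried_by Y F \<Sigma> (cone_extension N c H g)"
  unfolding carried_by_def
proof
  fix \<sigma> assume \<sigma>: "\<sigma> \<in> \<Sigma>"
  show "continuous_map (simplex_topology \<sigma>) (subtopology Y (F \<sigma>)) (cone_extension N c H g)"
  proof (cases "\<sigma> \<inter> N = {}")
    case True
    show ?thesis
      by (rule continuous_map_eq[OF off[OF \<sigma> True]])
         (use True in \<open>auto simp: cone_extension_off_vertices\<close>)
  next
    case False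
    then obtain v where v: "v \<in> \<sigma> \<inter> N" by blast
    then have vN: "v \<in> N" and insert_v: "insert v (\<sigma> - {v}) = \<sigma>" by auto
    then have "continuous_map (simplex_topology (insert v (\<sigma> - {v}))) (subtopology Y (B v))
        (cone_map v (c v) (H v))"
      using on[OF \<sigma> v] \<sigma>
      by (intro continuous_map_cone_map[OF _ _ _ null[OF vN]]) (auto simp: link_def)
    then have "continuous_map (simplex_topology \<sigma>) (subtopology Y (F \<sigma>)) (cone_map v (c v) (H v))"
      using on[OF \<sigma> v] unfolding insert_v continuous_map_in_subtopology by auto
    then show ?thesis
      by (rule continuous_map_eq)
         (use on[OF \<sigma> v] null[OF vN] in \<open>auto simp: null_homotopy_def cone_extension_eq_cone_map\<close>)
  qed
qed

section \<open>Maps on nerves\<close>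

definition nerve :: "'v set \<Rightarrow> ('v \<Rightarrow> 'a set) \<Rightarrow> 'v set set" where
  "nerve S C = {\<sigma>. finite \<sigma> \<and> \<sigma> \<noteq> {} \<and> \<sigma> \<subseteq> S \<and> (\<Inter>v\<in>\<sigma>. C v) \<noteq> {}}"

lemma simplicial_complex_nerve: "simplicial_complex (nerve S C)"
  unfolding simplicial_complex_def
proof (intro ballI conjI allI impI)
  fix \<sigma> assume \<sigma>: "\<sigma> \<in> nerve S C"
  then show "finite \<sigma>" "\<sigma> \<noteq> {}" by (auto simp: nerve_def)
  fix \<tau> assume \<tau>: "\<tau> \<subseteq> \<sigma> \<and> \<tau> \<noteq> {}"
  have "(\<Inter>v\<in>\<sigma>. C v) \<subseteq> (\<Inter>v\<in>\<tau>. C v)" using \<tau> by blast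
  then show "\<tau> \<in> nerve S C" using \<sigma> \<tau> by (auto simp: nerve_def intro: finite_subset)
qed

definition nerve_carrier :: "('v \<Rightarrow> 'a set) \<Rightarrow> ('a \<Rightarrow> 'b set) \<Rightarrow> 'v set \<Rightarrow> 'b set" where
  "nerve_carrier C R \<sigma> = (\<Inter>p\<in>(\<Inter>v\<in>\<sigma>. C v). R p)"

definition uniform_hook ::
    "'v itself \<Rightarrow> 'b metric \<Rightarrow> 'a set \<Rightarrow> ('a \<Rightarrow> 'b set) \<Rightarrow> ('a \<Rightarrow> 'b set) \<Rightarrow> bool" where
  "uniform_hook V m P R' R \<longleftrightarrow>
     (\<exists>A B. hook_omega V m A B \<and> B \<noteq> {} \<and> B \<subseteq> mspace m \<and> (\<forall>p\<in>P. R' p \<subseteq> A \<and> B \<subseteq> R p))"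

lemma uniform_hook_mono:
  assumes "uniform_hook V m P R' R" "Q \<subseteq> P"
    and "\<And>p. p \<in> Q \<Longrightarrow> T' p \<subseteq> R' p" "\<And>p. p \<in> Q \<Longrightarrow> R p \<subseteq> T p"
  shows "uniform_hook V m Q T' T"
proof -
  obtain A B where AB: "hook_omega V m A B" "B \<noteq> {}" "B \<subseteq> mspace m" "\<forall>p\<in>P. R' p \<subseteq> A \<and> B \<subseteq> R p"
    using assms(1) unfolding uniform_hook_def by blast
  have "\<forall>p\<in>Q. T' p \<subseteq> A \<and> B \<subseteq> T p" using AB(4) assms(2-4) by blast
  then show ?thesis using AB(1-3) unfolding uniform_hook_def by blast
qed

locale levelled_family =
  fixes S :: "'v set" and C :: "'v \<Rightarrow> 'a set" and lev :: "'v \<Rightarrow> nat" and k :: nat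
  assumes level_less: "v \<in> S \<Longrightarrow> lev v < k"
    and same_level_disjnt: "v \<in> S \<Longrightarrow> w \<in> S \<Longrightarrow> lev v = lev w \<Longrightarrow> v \<noteq> w \<Longrightarrow> disjnt (C v) (C w)"
begin

abbreviation nerve_above :: "nat \<Rightarrow> 'v set set" where
  "nerve_above n \<equiv> nerve {v\<in>S. n \<le> lev v} C"

lemma inj_on_level:
  assumes "\<sigma> \<in> nerve S C"
  shows "inj_on lev \<sigma>"
proof (rule inj_onI, rule ccontr)
  fix v w assume "v \<in> \<sigma>" "w \<in> \<sigma>" "lev v = lev w" "v \<noteq> w"
  then have "disjnt (C v) (C w)" using assms by (intro same_level_disjnt) (auto simp: nerve_def)
  then show False using assms \<open>v \<in> \<sigma>\<close> \<open>w \<in> \<sigma>\<close> by (auto simp: nerve_def disjnt_iff)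
qed

lemma nerve_above_subset: "nerve_above n \<subseteq> nerve S C"
  by (auto simp: nerve_def)

lemma nerve_above_level:
  assumes \<sigma>: "\<sigma> \<in> nerve_above n" and v: "v \<in> \<sigma>" "lev v = n"
  shows "\<sigma> \<inter> {v\<in>S. lev v = n} = {v}" "\<sigma> - {v} = {} \<or> \<sigma> - {v} \<in> nerve_above (Suc n)"
proof -
  have \<sigma>S: "\<sigma> \<subseteq> S" "\<And>w. w \<in> \<sigma> \<Longrightarrow> n \<le> lev w" using \<sigma> by (auto simp: nerve_def)
  have "\<sigma> \<in> nerve S C" using \<sigma> nerve_above_subset by blast
  then have unique: "w = v" if "w \<in> \<sigma>" "lev w = n" for w
    using inj_onD[OF inj_on_level, of \<sigma> w v] that v by simp
  then show "\<sigma> \<inter> {v\<in>S. lev v = n} = {v}" using v \<sigma>S(1) by blast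
  have "Suc n \<le> lev w" if "w \<in> \<sigma> - {v}" for w
    using that unique[of w] \<sigma>S(2)[of w] by (auto simp: Suc_le_eq order_less_le)
  then show "\<sigma> - {v} = {} \<or> \<sigma> - {v} \<in> nerve_above (Suc n)"
    using \<sigma> by (auto simp: nerve_def)
qed

lemma finite_dimensional_subset_nerve:
  assumes "K \<subseteq> nerve S C"
  shows "finite_dimensional K"
  unfolding finite_dimensional_def
proof (intro exI[of _ k] ballI)
  fix \<sigma> assume "\<sigma> \<in> K"
  then have \<sigma>: "\<sigma> \<in> nerve S C" using assms by blast
  then have "lev ` \<sigma> \<subseteq> {..<k}" using level_less by (auto simp: nerve_def)
  then have "card \<sigma> \<le> card {..<k}" using inj_on_level[OF \<sigma>] by (intro card_inj_on_le) auto
  then show "card \<sigma> \<le> k + 1" by simp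
qed

lemma null_homotopy_on_link:
  assumes g: "carried_by (mtopology_of m) (nerve_carrier C R') (nerve_above (Suc n)) g"
    and hook: "uniform_hook TYPE('v) m (C v) R' R"
  shows "\<exists>B c H. null_homotopy (whitehead_topology (link (nerve_above n) (nerve_above (Suc n)) v))
      (subtopology (mtopology_of m) B) g c H \<and> (\<forall>p\<in>C v. B \<subseteq> R p)"
proof -
  let ?L = "link (nerve_above n) (nerve_above (Suc n)) v"
  obtain A B where AB: "hook_omega TYPE('v) m A B" "B \<noteq> {}" "B \<subseteq> mspace m"
      "\<forall>p\<in>C v. R' p \<subseteq> A \<and> B \<subseteq> R p"
    using hook unfolding uniform_hook_def by blast
  have "continuous_map (simplex_topology \<tau>) (subtopology (mtopology_of m) A) g" if \<tau>: "\<tau> \<in> ?L" for \<tau>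
  proof -
    obtain p where p: "p \<in> C v" "p \<in> (\<Inter>w\<in>\<tau>. C w)" using \<tau> by (auto simp: link_def nerve_def)
    then have "nerve_carrier C R' \<tau> \<subseteq> A" using AB(4) unfolding nerve_carrier_def by blast
    moreover have "continuous_map (simplex_topology \<tau>)
        (subtopology (mtopology_of m) (nerve_carrier C R' \<tau>)) g"
      using g \<tau> by (simp add: carried_by_def link_def)
    ultimately show ?thesis by (auto simp: continuous_map_in_subtopology)
  qed
  then have "continuous_map (whitehead_topology ?L) (subtopology (mtopology_of m) A) g"
    by (simp add: continuous_map_whitehead_topology)
  moreover have "simplicial_complex ?L" by (intro simplicial_complex_link simplicial_complex_nerve)
  moreover have "finite_dimensional ?L"
    using nerve_above_subset by (intro finite_dimensional_subset_nerve) (auto simp: link_def)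
  ultimately have "\<exists>c H. null_homotopy (whitehead_topology ?L) (subtopology (mtopology_of m) B) g c H"
    by (intro hook_omega_null_homotopy[OF AB(1-3)])
  then show ?thesis using AB(4) by blast
qed

lemma carried_by_nerve_step:
  assumes g: "carried_by (mtopology_of m) (nerve_carrier C R') (nerve_above (Suc n)) g"
    and hook: "\<And>v. v \<in> S \<Longrightarrow> lev v = n \<Longrightarrow> uniform_hook TYPE('v) m (C v) R' R"
    and mono: "\<And>v p. v \<in> S \<Longrightarrow> p \<in> C v \<Longrightarrow> R' p \<subseteq> R p"
  shows "\<exists>g. carried_by (mtopology_of m) (nerve_carrier C R) (nerve_above n) g"
proof -
  define N where "N = {v\<in>S. lev v = n}"
  let ?L = "link (nerve_above n) (nerve_above (Suc n))"
  have "\<forall>v\<in>N. \<exists>B c H. null_homotopy (whitehead_topology (?L v)) (subtopology (mtopology_of m) B) g c H \<and>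
      (\<forall>p\<in>C v. B \<subseteq> R p)"
    by (intro ballI null_homotopy_on_link[OF g] hook) (auto simp: N_def)
  then obtain B c H where null_homotopies: "\<forall>v\<in>N. null_homotopy (whitehead_topology (?L v))
      (subtopology (mtopology_of m) (B v)) g (c v) (H v) \<and> (\<forall>p\<in>C v. B v \<subseteq> R p)"
    unfolding bchoice_iff by (elim exE)
  have null: "null_homotopy (whitehead_topology (?L v)) (subtopology (mtopology_of m) (B v)) g
      (c v) (H v)"
    and B: "\<And>p. p \<in> C v \<Longrightarrow> B v \<subseteq> R p" if "v \<in> N" for v
    using null_homotopies that by auto
  have "carried_by (mtopology_of m) (nerve_carrier C R) (nerve_above n) (cone_extension N c H g)"
  proof (rule carried_by_cone_extension)
    show "null_homotopy (whitehead_topology (?L v)) (subtopology (mtopology_of m) (B v)) g (c v) (H v)"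
      if "v \<in> N" for v
      using that by (rule null)
    fix \<sigma> assume \<sigma>: "\<sigma> \<in> nerve_above n"
    show "continuous_map (simplex_topology \<sigma>) (subtopology (mtopology_of m) (nerve_carrier C R \<sigma>)) g"
      if "\<sigma> \<inter> N = {}"
    proof -
      have "\<sigma> \<in> nerve_above (Suc n)"
        using \<sigma> that by (fastforce simp: nerve_def N_def Suc_le_eq order_less_le)
      moreover have "nerve_carrier C R' \<sigma> \<subseteq> nerve_carrier C R \<sigma>"
        using mono \<sigma> by (fastforce simp: nerve_carrier_def nerve_def)
      ultimately show ?thesis using g by (auto simp: carried_by_def continuous_map_in_subtopology)
    qed
    fix v assume v: "v \<in> \<sigma> \<inter> N"
    then have "B v \<subseteq> nerve_carrier C R \<sigma>" using B by (auto simp: nerve_carrier_def)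
    moreover have "finite \<sigma>" using \<sigma> by (simp add: nerve_def)
    ultimately show "finite \<sigma> \<and> \<sigma> \<inter> N = {v} \<and> B v \<subseteq> nerve_carrier C R \<sigma> \<and>
        (\<sigma> - {v} = {} \<or> \<sigma> - {v} \<in> nerve_above (Suc n))"
      using nerve_above_level[OF \<sigma>, of v] v unfolding N_def by blast
  qed
  then show ?thesis by blast
qed

lemma carried_by_nerve_exists:
  assumes hook: "\<And>v. v \<in> S \<Longrightarrow> uniform_hook TYPE('v) m (C v) (R (Suc (lev v))) (R (lev v))"
    and mono: "\<And>n v p. v \<in> S \<Longrightarrow> p \<in> C v \<Longrightarrow> R (Suc n) p \<subseteq> R n p"
  shows "\<exists>g. carried_by (mtopology_of m) (nerve_carrier C (R 0)) (nerve S C) g"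
proof -
  have "\<exists>g. carried_by (mtopology_of m) (nerve_carrier C (R 0)) (nerve_above 0) g"
    using le0[of k]
  proof (induction rule: inc_induct)
    case base
    have "nerve_above k = {}" using level_less by (fastforce simp: nerve_def)
    then show ?case by (simp add: carried_by_def)
  next
    case (step n)
    then obtain g
      where "carried_by (mtopology_of m) (nerve_carrier C (R (Suc n))) (nerve_above (Suc n)) g"
      by blast
    then show ?case by (rule carried_by_nerve_step) (use hook mono in auto)
  qed
  then show ?thesis by simp
qed

end

section \<open>Canonical maps into nerves\<close>

lemma geom_simplex_support:
  assumes \<alpha>: "\<alpha> \<in> geom_simplex \<sigma>" and fin: "finite \<sigma>" "finite \<tau>" and support: "\<And>v. v \<notin> \<tau> \<Longrightarrow> \<alpha> v = 0"
  shows "\<alpha> \<in> geom_simplex \<tau>"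
proof -
  have zero: "\<alpha> v = 0" if "v \<notin> \<sigma>" for v using \<alpha> that by (simp add: geom_simplex_def)
  have "sum \<alpha> \<tau> = sum \<alpha> (\<sigma> \<inter> \<tau>)"
    using fin zero by (intro sum.mono_neutral_right) auto
  also have "\<dots> = sum \<alpha> \<sigma>"
    using fin support by (intro sum.mono_neutral_left) auto
  finally show ?thesis using \<alpha> support by (simp add: geom_simplex_def)
qed

lemma closedin_geom_simplex:
  fixes \<sigma> :: "'v set"
  shows "closedin (powertop_real UNIV) (geom_simplex \<sigma>)"
proof -
  have "closed {\<alpha>::'v \<Rightarrow> real. (\<forall>v. 0 \<le> \<alpha> v) \<and> (\<forall>v. v \<notin> \<sigma> \<longrightarrow> \<alpha> v = 0) \<and> sum \<alpha> \<sigma> = 1}"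
    by (intro closed_Collect_conj closed_Collect_all closed_Collect_imp closed_Collect_le closed_Collect_eq
          continuous_intros continuous_on_product_coordinates) auto
  then show ?thesis by (simp add: geom_simplex_def euclidean_product_topology)
qed

lemma continuous_map_into_whitehead_topology:
  assumes \<Sigma>: "simplicial_complex \<Sigma>"
    and coords: "\<And>v. continuous_map X euclideanreal (\<lambda>x. \<kappa> x v)"
    and loc_finite: "locally_finite_family X UNIV (\<lambda>v. {x \<in> topspace X. \<kappa> x v \<noteq> 0})"
    and \<kappa>: "\<And>x. x \<in> topspace X \<Longrightarrow> \<kappa> x \<in> realization \<Sigma>"
  shows "continuous_map X (whitehead_topology \<Sigma>) \<kappa>"
proof (rule continuous_map_locally)
  fix x assume "x \<in> topspace X"
  then obtain N where N: "openin X N" "x \<in> N" "finite {v. {y \<in> topspace X. \<kappa> y v \<noteq> 0} \<inter> N \<noteq> {}}"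
    using loc_finite unfolding locally_finite_family_def by (simp only: UNIV_I simp_thms) blast
  define F where "F = {v. {y \<in> topspace X. \<kappa> y v \<noteq> 0} \<inter> N \<noteq> {}}"
  have "finite F" using N(3) by (simp add: F_def)
  let ?N = "subtopology X N"
  have \<kappa>N: "continuous_map ?N (powertop_real UNIV) \<kappa>"
    using coords by (simp add: continuous_map_componentwise_UNIV continuous_map_from_subtopology)
  define Z where "Z \<tau> = {y \<in> topspace ?N. \<kappa> y \<in> geom_simplex \<tau>}" for \<tau>
  have "continuous_map ?N (whitehead_topology \<Sigma>) \<kappa>"
  proof (rule pasting_lemma_closed[where I="{\<tau>\<in>\<Sigma>. \<tau> \<subseteq> F}" and T=Z and f="\<lambda>_. \<kappa>"])
    show "finite {\<tau>\<in>\<Sigma>. \<tau> \<subseteq> F}"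
      by (rule finite_subset[of _ "Pow F"]) (use \<open>finite F\<close> in auto)
    show "closedin ?N (Z \<tau>)" for \<tau>
      unfolding Z_def by (rule closedin_continuous_map_preimage[OF \<kappa>N closedin_geom_simplex])
    show "continuous_map (subtopology ?N (Z \<tau>)) (whitehead_topology \<Sigma>) \<kappa>" if "\<tau> \<in> {\<tau>\<in>\<Sigma>. \<tau> \<subseteq> F}" for \<tau>
    proof -
      have "continuous_map (subtopology ?N (Z \<tau>)) (simplex_topology \<tau>) \<kappa>"
        using continuous_map_from_subtopology[OF \<kappa>N]
        by (auto simp: continuous_map_in_subtopology Z_def)
      then show ?thesis
        by (rule continuous_map_into_simplex_imp_whitehead) (use that in simp)
    qed
    show "\<exists>\<tau>. \<tau> \<in> {\<tau>\<in>\<Sigma>. \<tau> \<subseteq> F} \<and> y \<in> Z \<tau> \<and> \<kappa> y = \<kappa> y" if y: "y \<in> topspace ?N" for y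
    proof -
      obtain \<sigma> where \<sigma>: "\<sigma> \<in> \<Sigma>" "\<kappa> y \<in> geom_simplex \<sigma>" using \<kappa> y by (auto simp: realization_def)
      have "finite \<sigma>" using \<Sigma> \<sigma>(1) by (simp add: simplicial_complex_def)
      have "\<kappa> y v = 0" if "v \<notin> \<sigma> \<inter> F" for v
        using that \<sigma>(2) y by (auto simp: geom_simplex_def F_def)
      then have \<sigma>F: "\<kappa> y \<in> geom_simplex (\<sigma> \<inter> F)"
        using \<open>finite \<sigma>\<close> by (intro geom_simplex_support[OF \<sigma>(2)]) auto
      then have "\<sigma> \<inter> F \<noteq> {}" by (auto simp: geom_simplex_def)
      then have "\<sigma> \<inter> F \<in> \<Sigma>" by (rule simplicial_complex_face[OF \<Sigma> \<sigma>(1) Int_lower1])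
      then show ?thesis using \<sigma>F y by (auto simp: Z_def)
    qed
  qed simp
  then show "\<exists>N. openin X N \<and> x \<in> N \<and> continuous_map (subtopology X N) (whitehead_topology \<Sigma>) \<kappa>"
    using N by blast
qed

context bump_family
begin

definition barycentric :: "'a \<Rightarrow> 'i \<Rightarrow> real" where
  "barycentric x i = (if i \<in> I then u i x / weighted_sum (\<lambda>_. 1) x else 0)"

lemma barycentric_eq_0_iff:
  assumes "x \<in> topspace X"
  shows "barycentric x i = 0 \<longleftrightarrow> i \<notin> I \<or> u i x = 0"
  using weighted_sum_pos[OF assms, of "\<lambda>_. 1"] by (auto simp: barycentric_def)

lemma barycentric_geom_simplex:
  assumes x: "x \<in> topspace X"
  shows "barycentric x \<in> geom_simplex {i\<in>I. u i x \<noteq> 0}"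
proof -
  let ?\<sigma> = "{i\<in>I. u i x \<noteq> 0}" and ?s = "weighted_sum (\<lambda>_. 1) x"
  have s_pos: "0 < ?s" by (rule weighted_sum_pos[OF x]) simp
  have "sum (barycentric x) ?\<sigma> = (\<Sum>i\<in>?\<sigma>. u i x / ?s)"
    by (intro sum.cong) (auto simp: barycentric_def)
  also have "\<dots> = (\<Sum>i\<in>?\<sigma>. u i x) / ?s" by (rule sum_divide_distrib[symmetric])
  also have "(\<Sum>i\<in>?\<sigma>. u i x) = ?s" by (simp add: weighted_sum_def)
  finally have "sum (barycentric x) ?\<sigma> = 1" using s_pos by simp
  then show ?thesis
    using nonneg[OF _ x] s_pos by (auto simp: geom_simplex_def barycentric_def less_imp_le)
qed

lemma support_in_nerve:
  assumes x: "x \<in> topspace X"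
  shows "{i\<in>I. u i x \<noteq> 0} \<in> nerve I U" "x \<in> (\<Inter>i\<in>{i\<in>I. u i x \<noteq> 0}. U i)"
proof -
  show mem: "x \<in> (\<Inter>i\<in>{i\<in>I. u i x \<noteq> 0}. U i)" using subordinate[OF _ x] by auto
  have "{i\<in>I. u i x \<noteq> 0} \<noteq> {}" using ex_peak[OF x] by force
  then show "{i\<in>I. u i x \<noteq> 0} \<in> nerve I U"
    using finite_support[OF x] mem unfolding nerve_def by blast
qed

lemma continuous_map_barycentric: "continuous_map X (whitehead_topology (nerve I U)) barycentric"
proof (rule continuous_map_into_whitehead_topology[OF simplicial_complex_nerve])
  show "continuous_map X euclideanreal (\<lambda>x. barycentric x i)" for i
  proof (cases "i \<in> I")
    case True
    have "weighted_sum (\<lambda>_. 1) x \<noteq> 0" if "x \<in> topspace X" for x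
      using weighted_sum_pos[OF that, of "\<lambda>_. 1"] by simp
    then have "continuous_map X euclideanreal (\<lambda>x. u i x / weighted_sum (\<lambda>_. 1) x)"
      by (intro continuous_map_real_divide continuous[OF True] continuous_map_weighted_sum)
    then show ?thesis using True by (simp add: barycentric_def)
  qed (simp add: barycentric_def)
  show "barycentric x \<in> realization (nerve I U)" if "x \<in> topspace X" for x
    using barycentric_geom_simplex[OF that] support_in_nerve(1)[OF that] unfolding realization_def
    by blast
  show "locally_finite_family X UNIV (\<lambda>i. {x \<in> topspace X. barycentric x i \<noteq> 0})"
    unfolding locally_finite_family_def
  proof
    fix x assume "x \<in> topspace X"
    then obtain N where N: "openin X N" "x \<in> N" "finite {i\<in>I. \<exists>y\<in>N. u i y \<noteq> 0}"
      by (rule finite_local_support)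
    have "{i\<in>UNIV. {y \<in> topspace X. barycentric y i \<noteq> 0} \<inter> N \<noteq> {}} \<subseteq> {i\<in>I. \<exists>y\<in>N. u i y \<noteq> 0}"
      by (auto simp: barycentric_eq_0_iff)
    then show "\<exists>N. openin X N \<and> x \<in> N \<and> finite {i\<in>UNIV. {y \<in> topspace X. barycentric y i \<noteq> 0} \<inter> N \<noteq> {}}"
      using N finite_subset by blast
  qed
qed

end

lemma carried_by_nerve_selection:
  assumes paracompact: "paracompact_space X" and C: "indexed_open_cover X S C"
    and g: "carried_by Y (nerve_carrier C R) (nerve S C) g"
  shows "\<exists>f. continuous_map X Y f \<and> (\<forall>x\<in>topspace X. f x \<in> R x)"
proof -
  obtain u where "bump_family X S C u" by (rule paracompact_space_bump_family[OF paracompact C])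
  then interpret bump_family X S C u .
  have g_simplex: "continuous_map (simplex_topology \<sigma>) (subtopology Y (nerve_carrier C R \<sigma>)) g"
    if "\<sigma> \<in> nerve S C" for \<sigma>
    using g that by (simp add: carried_by_def)
  then have "continuous_map (whitehead_topology (nerve S C)) Y g"
    by (simp add: continuous_map_whitehead_topology continuous_map_in_subtopology)
  then have "continuous_map X Y (g \<circ> barycentric)"
    by (rule continuous_map_compose[OF continuous_map_barycentric])
  moreover have "g (barycentric x) \<in> R x" if x: "x \<in> topspace X" for x
  proof -
    have "g (barycentric x) \<in> nerve_carrier C R {v\<in>S. u v x \<noteq> 0}"
      using continuous_map_image_subset_topspace[OF g_simplex[OF support_in_nerve(1)[OF x]]]
        barycentric_geom_simplex[OF x] by auto
    then show ?thesis using support_in_nerve(2)[OF x] unfolding nerve_carrier_def by blast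
  qed
  ultimately show ?thesis by (intro exI[of _ "g \<circ> barycentric"]) simp
qed

section \<open>Scales and selections\<close>

lemma Onbhd_mono: "a \<le> b \<Longrightarrow> Onbhd m a S \<subseteq> Onbhd m b S"
  unfolding Onbhd_def by force

lemma subset_Onbhd:
  assumes "S \<subseteq> mspace m" "0 < a"
  shows "S \<subseteq> Onbhd m a S"
proof
  fix x assume x: "x \<in> S"
  then have "mdist m x x < a" using assms by (metis mdist_zero subsetD)
  then show "x \<in> Onbhd m a S" using x assms by (auto simp: Onbhd_def)
qed

lemma Onbhd_Onbhd:
  assumes "S \<subseteq> Onbhd m a T" "T \<subseteq> mspace m"
  shows "Onbhd m b S \<subseteq> Onbhd m (a + b) T"
proof
  fix y assume "y \<in> Onbhd m b S"
  then obtain q where q: "y \<in> mspace m" "q \<in> S" "mdist m y q < b" by (auto simp: Onbhd_def)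
  then obtain t where t: "q \<in> mspace m" "t \<in> T" "mdist m q t < a"
    using assms(1) by (auto simp: Onbhd_def)
  have "mdist m y t \<le> mdist m y q + mdist m q t" using q t assms(2) by (intro mdist_triangle) auto
  then have "mdist m y t < a + b" using q t by linarith
  then show "y \<in> Onbhd m (a + b) T" using q t by (auto simp: Onbhd_def)
qed

lemma uniformly_UV_omega_local_hook:
  assumes \<phi>: "\<forall>x\<in>topspace X. \<phi> x \<noteq> {} \<and> \<phi> x \<subseteq> mspace m"
    and rho: "rho_continuous X m \<phi>" and UV: "uniformly_UV_omega T m (\<phi> x)"
    and e: "continuous_map X euclideanreal e" "0 < e x" and x: "x \<in> topspace X"
  shows "\<exists>d U. 0 < d \<and> openin X U \<and> x \<in> U \<and> (\<forall>p\<in>U. d \<le> e p) \<and>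
      uniform_hook T m U (\<lambda>p. Onbhd m d (\<phi> p)) (\<lambda>p. Onbhd m (e p) (\<phi> p))"
proof -
  define r where "r = e x / 4"
  have "0 < r" using e(2) by (simp add: r_def)
  then obtain d where d: "0 < d" "d \<le> r" "hook_omega T m (Onbhd m d (\<phi> x)) (Onbhd m r (\<phi> x))"
    using UV unfolding uniformly_UV_omega_def by blast
  obtain V where V: "openin X V" "x \<in> V"
    "\<And>p. p \<in> V \<Longrightarrow> \<phi> x \<subseteq> Onbhd m (d / 2) (\<phi> p) \<and> \<phi> p \<subseteq> Onbhd m (d / 2) (\<phi> x)"
    using rho x d(1) unfolding rho_continuous_def by (meson half_gt_zero)
  define U where "U = V \<inter> {p \<in> topspace X. 2 * r < e p}"
  have "openin X U" unfolding U_def using V(1) e(1) by (intro openin_Int openin_Collect_less) auto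
  moreover have "x \<in> U" using V(2) x e(2) by (simp add: U_def r_def)
  moreover have "d / 2 \<le> e p" if "p \<in> U" for p using that d by (simp add: U_def)
  moreover have "uniform_hook T m U (\<lambda>p. Onbhd m (d / 2) (\<phi> p)) (\<lambda>p. Onbhd m (e p) (\<phi> p))"
    unfolding uniform_hook_def
  proof (intro exI conjI ballI)
    show "Onbhd m r (\<phi> x) \<noteq> {}" using subset_Onbhd[of "\<phi> x" m r] \<phi> x \<open>0 < r\<close> by blast
    fix p assume p: "p \<in> U"
    then have pX: "p \<in> topspace X" by (simp add: U_def)
    have near: "\<phi> x \<subseteq> Onbhd m (d / 2) (\<phi> p)" "\<phi> p \<subseteq> Onbhd m (d / 2) (\<phi> x)"
      using V(3) p by (auto simp: U_def)
    show "Onbhd m (d / 2) (\<phi> p) \<subseteq> Onbhd m d (\<phi> x)"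
      using Onbhd_Onbhd[OF near(2), of "d / 2"] \<phi> x by simp
    have "Onbhd m r (\<phi> x) \<subseteq> Onbhd m (d / 2 + r) (\<phi> p)"
      using near(1) \<phi> pX by (intro Onbhd_Onbhd) auto
    also have "\<dots> \<subseteq> Onbhd m (e p) (\<phi> p)" using p d by (intro Onbhd_mono) (simp add: U_def)
    finally show "Onbhd m r (\<phi> x) \<subseteq> Onbhd m (e p) (\<phi> p)" .
  qed (use d(3) in \<open>auto simp: Onbhd_def\<close>)
  ultimately show ?thesis using d(1) by (intro exI[of _ "d / 2"] exI[of _ U]) simp
qed

definition positive_function :: "'a topology \<Rightarrow> ('a \<Rightarrow> real) \<Rightarrow> bool" where
  "positive_function X e \<longleftrightarrow> continuous_map X euclideanreal e \<and> (\<forall>x\<in>topspace X. 0 < e x)"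

lemma uniformly_UV_omega_next_scale:
  assumes paracompact: "paracompact_space X"
    and \<phi>: "\<forall>x\<in>topspace X. \<phi> x \<noteq> {} \<and> \<phi> x \<subseteq> mspace m"
    and rho: "rho_continuous X m \<phi>"
    and UV: "\<forall>x\<in>topspace X. uniformly_UV_omega T m (\<phi> x)"
    and e: "positive_function X e"
  shows "\<exists>e' \<U>. positive_function X e' \<and> (\<forall>x\<in>topspace X. e' x \<le> e x) \<and> open_cover X \<U> \<and>
      (\<forall>U\<in>\<U>. uniform_hook T m U (\<lambda>p. Onbhd m (e' p) (\<phi> p)) (\<lambda>p. Onbhd m (e p) (\<phi> p)))"
proof -
  have "\<forall>x\<in>topspace X. \<exists>d U. 0 < d \<and> openin X U \<and> x \<in> U \<and> (\<forall>p\<in>U. d \<le> e p) \<and>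
      uniform_hook T m U (\<lambda>p. Onbhd m d (\<phi> p)) (\<lambda>p. Onbhd m (e p) (\<phi> p))"
    using UV e
    by (intro ballI uniformly_UV_omega_local_hook[OF \<phi> rho]) (auto simp: positive_function_def)
  then obtain d U
    where local_hooks: "\<forall>x\<in>topspace X. 0 < d x \<and> openin X (U x) \<and> x \<in> U x \<and> (\<forall>p\<in>U x. d x \<le> e p) \<and>
      uniform_hook T m (U x) (\<lambda>p. Onbhd m (d x) (\<phi> p)) (\<lambda>p. Onbhd m (e p) (\<phi> p))"
    unfolding bchoice_iff by (elim exE)
  have cover: "indexed_open_cover X (topspace X) U" using local_hooks by (auto simp: indexed_open_cover_def)
  have d_pos: "\<forall>x\<in>topspace X. 0 < d x" using local_hooks by blast
  obtain e' where e': "continuous_map X euclideanreal e'" "\<And>p. p \<in> topspace X \<Longrightarrow> 0 < e' p"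
    and small: "\<And>p. p \<in> topspace X \<Longrightarrow> \<exists>x\<in>topspace X. p \<in> U x \<and> e' p < d x"
    by (rule paracompact_space_positive_minorant[OF paracompact cover d_pos]) (rule that)
  define U' where "U' x = U x \<inter> {p \<in> topspace X. e' p < d x}" for x
  have "positive_function X e'" using e' by (simp add: positive_function_def)
  moreover have "\<forall>p\<in>topspace X. e' p \<le> e p"
    using small local_hooks by (meson less_imp_le order_less_le_trans)
  moreover have "open_cover X (U' ` topspace X)"
  proof (rule open_coverI)
    show "openin X V" if "V \<in> U' ` topspace X" for V
      using that local_hooks e'(1) by (auto simp: U'_def intro!: openin_Collect_less)
  qed (use small in \<open>auto simp: U'_def\<close>)
  moreover have "uniform_hook T m V (\<lambda>p. Onbhd m (e' p) (\<phi> p)) (\<lambda>p. Onbhd m (e p) (\<phi> p))"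
    if "V \<in> U' ` topspace X" for V
  proof -
    obtain x where x: "x \<in> topspace X" "V = U' x" using \<open>V \<in> U' ` topspace X\<close> by blast
    then have "uniform_hook T m (U x) (\<lambda>p. Onbhd m (d x) (\<phi> p)) (\<lambda>p. Onbhd m (e p) (\<phi> p))"
      using local_hooks by blast
    then show ?thesis by (rule uniform_hook_mono) (auto simp: x(2) U'_def intro!: Onbhd_mono)
  qed
  ultimately show ?thesis by blast
qed

lemma uniformly_UV_omega_scales:
  assumes paracompact: "paracompact_space X"
    and \<phi>: "\<forall>x\<in>topspace X. \<phi> x \<noteq> {} \<and> \<phi> x \<subseteq> mspace m"
    and rho: "rho_continuous X m \<phi>"
    and UV: "\<forall>x\<in>topspace X. uniformly_UV_omega T m (\<phi> x)"
    and \<epsilon>: "positive_function X \<epsilon>"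
  obtains E \<U> where "E 0 = \<epsilon>" "\<And>n x. x \<in> topspace X \<Longrightarrow> E (Suc n) x \<le> E n x" "\<And>n. open_cover X (\<U> n)"
    "\<And>n U. U \<in> \<U> n \<Longrightarrow>
        uniform_hook T m U (\<lambda>p. Onbhd m (E (Suc n) p) (\<phi> p)) (\<lambda>p. Onbhd m (E n p) (\<phi> p))"
proof -
  define next_scale where "next_scale e e' \<U> \<longleftrightarrow> (\<forall>x\<in>topspace X. e' x \<le> e x) \<and> open_cover X \<U> \<and>
      (\<forall>U\<in>\<U>. uniform_hook T m U (\<lambda>p. Onbhd m (e' p) (\<phi> p)) (\<lambda>p. Onbhd m (e p) (\<phi> p)))" for e e' \<U>
  have "\<exists>E. \<forall>n. (positive_function X (E n) \<and> (n = 0 \<longrightarrow> E n = \<epsilon>)) \<and> (\<exists>\<U>. next_scale (E n) (E (Suc n)) \<U>)"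
  proof (rule dependent_nat_choice)
    fix e and n :: nat assume "positive_function X e \<and> (n = 0 \<longrightarrow> e = \<epsilon>)"
    then show "\<exists>e'. (positive_function X e' \<and> (Suc n = 0 \<longrightarrow> e' = \<epsilon>)) \<and> (\<exists>\<U>. next_scale e e' \<U>)"
      using uniformly_UV_omega_next_scale[OF paracompact \<phi> rho UV, of e]
      by (auto simp: next_scale_def)
  qed (use \<epsilon> in blast)
  then obtain E where E: "E 0 = \<epsilon>" "\<And>n. \<exists>\<U>. next_scale (E n) (E (Suc n)) \<U>" by blast
  then obtain \<U> where "\<And>n. next_scale (E n) (E (Suc n)) (\<U> n)" by metis
  then show ?thesis by (intro that[of E \<U>] E(1)) (auto simp: next_scale_def)
qed

text \<open>The vertices of the nerve are the pairs \<open>(n, V)\<close> with \<open>V\<close> in the \<open>n\<close>-th disjoint family, wrapped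
  into singletons to have the vertex type for which the UV property is assumed.\<close>
lemma disjoint_refinements_selection:
  fixes X :: "'a topology"
  assumes paracompact: "paracompact_space X" and ref: "disjoint_refinements X k \<U> (topspace X)"
    and hook: "\<And>n U. U \<in> \<U> n \<Longrightarrow> uniform_hook TYPE((nat \<times> 'a set) set) m U (R (Suc n)) (R n)"
    and mono: "\<And>n x. x \<in> topspace X \<Longrightarrow> R (Suc n) x \<subseteq> R n x"
  shows "\<exists>f. continuous_map X (mtopology_of m) f \<and> (\<forall>x\<in>topspace X. f x \<in> R 0 x)"
proof -
  obtain \<V> where \<V>: "\<And>n. n < k \<Longrightarrow> disjoint_open_refinement X (\<U> n) (\<V> n)"
    "topspace X \<subseteq> (\<Union>n<k. \<Union>(\<V> n))"
    by (rule disjoint_refinementsE[OF ref]) (rule that)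
  define S where "S = (\<lambda>w. {w}) ` (SIGMA n:{..<k}. \<V> n)"
  define lev where "lev v = fst (the_elem v)" for v :: "(nat \<times> 'a set) set"
  define C where "C v = snd (the_elem v)" for v :: "(nat \<times> 'a set) set"
  have vertex: "lev v < k" "C v \<in> \<V> (lev v)" "v = {(lev v, C v)}" if "v \<in> S" for v
    using that by (auto simp: S_def lev_def C_def)
  have open_C: "openin X (C v)" if "v \<in> S" for v
    using vertex(1,2)[OF that] disjoint_open_refinementD(2)[OF \<V>(1)] by blast
  interpret levelled_family S C lev k
  proof
    show "lev v < k" if "v \<in> S" for v using that by (rule vertex(1))
    show "disjnt (C v) (C w)" if vw: "v \<in> S" "w \<in> S" "lev v = lev w" "v \<noteq> w" for v w
    proof -
      have "C v \<noteq> C w" using vertex(3)[OF vw(1)] vertex(3)[OF vw(2)] vw(3,4) by metis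
      then show ?thesis
        using vertex(1,2)[OF vw(1)] vertex(2)[OF vw(2)] vw(3) disjoint_open_refinementD(1)[OF \<V>(1)]
        by metis
    qed
  qed
  have "\<exists>v\<in>S. x \<in> C v" if x: "x \<in> topspace X" for x
  proof -
    obtain n V where "n < k" "V \<in> \<V> n" "x \<in> V" using \<V>(2) x by blast
    then show ?thesis by (intro bexI[of _ "{(n, V)}"]) (auto simp: S_def C_def)
  qed
  then have cover: "indexed_open_cover X S C" using open_C by (auto simp: indexed_open_cover_def)
  have "\<exists>g. carried_by (mtopology_of m) (nerve_carrier C (R 0)) (nerve S C) g"
  proof (rule carried_by_nerve_exists)
    fix v assume v: "v \<in> S"
    obtain U where U: "U \<in> \<U> (lev v)" "C v \<subseteq> U"
      using disjoint_open_refinementD(3)[OF \<V>(1)] vertex(1,2)[OF v] by blast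
    show "uniform_hook TYPE((nat \<times> 'a set) set) m (C v) (R (Suc (lev v))) (R (lev v))"
      by (rule uniform_hook_mono[OF hook[OF U(1)] U(2)]) simp_all
    show "R (Suc n) p \<subseteq> R n p" if "p \<in> C v" for n p
      using mono openin_subset[OF open_C[OF v]] that by blast
  qed
  then show ?thesis using carried_by_nerve_selection[OF paracompact cover] by blast
qed

theorem theorem5p2:
  fixes X :: "'a topology" and m :: "'b metric"
    and \<phi> :: "'a \<Rightarrow> 'b set" and \<epsilon> :: "'a \<Rightarrow> real"
  assumes "paracompact_space X" and "finite_C_space X"
    and "\<forall>x\<in>topspace X. \<phi> x \<noteq> {} \<and> \<phi> x \<subseteq> mspace m"
    and "rho_continuous X m \<phi>"
    and "\<forall>x\<in>topspace X. uniformly_UV_omega TYPE((nat \<times> 'a set) set) m (\<phi> x)"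
    and "continuous_map X euclideanreal \<epsilon>" and "\<forall>x\<in>topspace X. \<epsilon> x > 0"
  shows "\<exists>f. continuous_map X (mtopology_of m) f \<and>
             (\<forall>x\<in>topspace X. f x \<in> Onbhd m (\<epsilon> x) (\<phi> x))"
proof -
  have "positive_function X \<epsilon>" using assms(6,7) by (simp add: positive_function_def)
  then obtain E \<U> where E0: "E 0 = \<epsilon>" and decreasing: "\<And>n x. x \<in> topspace X \<Longrightarrow> E (Suc n) x \<le> E n x"
    and covers: "\<And>n. open_cover X (\<U> n)"
    and hooks: "\<And>n U. U \<in> \<U> n \<Longrightarrow> uniform_hook TYPE((nat \<times> 'a set) set) m U
          (\<lambda>p. Onbhd m (E (Suc n) p) (\<phi> p)) (\<lambda>p. Onbhd m (E n p) (\<phi> p))"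
    by (rule uniformly_UV_omega_scales[OF assms(1,3-5)]) (rule that)
  obtain k where "disjoint_refinements X k \<U> (topspace X)"
    using finite_C_space_open_covers[OF assms(1,2), of \<U>] covers by blast
  then have "\<exists>f. continuous_map X (mtopology_of m) f \<and> (\<forall>x\<in>topspace X. f x \<in> Onbhd m (E 0 x) (\<phi> x))"
    using hooks Onbhd_mono[OF decreasing]
    by (rule disjoint_refinements_selection[OF assms(1), where R="\<lambda>n p. Onbhd m (E n p) (\<phi> p)"])
  then show ?thesis unfolding E0 .
qed

end
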